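(* Let $\mathcal{H}$ be a Hilbert space, and let $\mathfrak{A}\subset B(\mathcal{H})$ be a unital $\mathrm{C}^*$-algebra containing the ideal $\mathfrak{K}$ of compact operators on $\mathcal{H}$ such that $\mathfrak{A}/\mathfrak{K}$ is commutative. Let $\mathcal{A}\subset\mathfrak{A}$ be a unital norm-closed subalgebra such that for every character $\omega$ on $\mathfrak{A}$ there is a pure contraction $t_\omega\in\mathcal{A}$ with $|\chi(t_\omega)|<1=\omega(t_\omega)$ for every character $\chi\neq\omega$ on $\mathfrak{A}$. Then every pure state on $\mathfrak{A}$ admits a characteristic sequence in $\mathfrak{S}+\mathfrak{K}$, where $\mathfrak{S}=\mathcal{A}+\mathcal{A}^*$ is the operator system generated by $\mathcal{A}$.
   Context: An operator $T\in B(\mathcal{H})$ is a pure contraction if $\|T\|\le1$ and $\lim_{n\to\infty}\|T^{*n}\xi\|=0$ for every $\xi\in\mathcal{H}$. A sequence $(\Delta_n)_n$ in $\mathfrak{A}$ is a characteristic sequence for a state $\psi$ if (a) $\|\Delta_n\|=1$ for all $n$, (b) $\lim_{n\to\infty}\psi(\Delta_n)=1$, and (c) $\limsup_{n\to\infty}\|\Delta_n^*a\Delta_n\|\le|\psi(a)|$ for every $a\in\mathfrak{A}$. *)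

theory Defs
  imports "HOL-Analysis.Analysis"
begin

text \<open>A complex Hilbert space, presented as a real Hilbert space (real inner product
  Re of the complex one) together with multiplication by the imaginary unit, jmul,
  which is a real-linear isometry with jmul o jmul = -id.\<close>
class chilbert = real_inner + complete_space +
  fixes jmul :: "'a \<Rightarrow> 'a"
  assumes jmul_add: "jmul (x + y) = jmul x + jmul y"
    and jmul_scaleR: "jmul (r *\<^sub>R x) = r *\<^sub>R jmul x"
    and jmul_jmul: "jmul (jmul x) = - x"
    and jmul_inner: "inner (jmul x) (jmul y) = inner x y"

definition clinear_op :: "('a::chilbert \<Rightarrow>\<^sub>L 'a) \<Rightarrow> bool" where
  "clinear_op T \<longleftrightarrow> (\<forall>x. blinfun_apply T (jmul x) = jmul (blinfun_apply T x))"

definition BH :: "('a::chilbert \<Rightarrow>\<^sub>L 'a) set" where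
  "BH = {T. clinear_op T}"

definition jop :: "'a::chilbert \<Rightarrow>\<^sub>L 'a" where
  "jop = Blinfun jmul"

definition cscaleL :: "complex \<Rightarrow> ('a::chilbert \<Rightarrow>\<^sub>L 'a) \<Rightarrow> ('a \<Rightarrow>\<^sub>L 'a)" where
  "cscaleL c T = Re c *\<^sub>R T + Im c *\<^sub>R (jop o\<^sub>L T)"

definition adjL :: "('a::chilbert \<Rightarrow>\<^sub>L 'a) \<Rightarrow> ('a \<Rightarrow>\<^sub>L 'a)" where
  "adjL T = (THE S. \<forall>x y. inner (blinfun_apply T x) y = inner x (blinfun_apply S y))"

definition compact_op :: "('a::chilbert \<Rightarrow>\<^sub>L 'a) \<Rightarrow> bool" where
  "compact_op T \<longleftrightarrow> compact (closure (blinfun_apply T ` ball 0 1))"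

definition Kset :: "('a::chilbert \<Rightarrow>\<^sub>L 'a) set" where
  "Kset = {T \<in> BH. compact_op T}"

definition complex_subspace :: "('a::chilbert \<Rightarrow>\<^sub>L 'a) set \<Rightarrow> bool" where
  "complex_subspace A \<longleftrightarrow> 0 \<in> A \<and> (\<forall>a\<in>A. \<forall>b\<in>A. a + b \<in> A) \<and> (\<forall>c. \<forall>a\<in>A. cscaleL c a \<in> A)"

definition unital_closed_subalg :: "('a::chilbert \<Rightarrow>\<^sub>L 'a) set \<Rightarrow> bool" where
  "unital_closed_subalg A \<longleftrightarrow> A \<subseteq> BH \<and> complex_subspace A \<and>
     (\<forall>a\<in>A. \<forall>b\<in>A. a o\<^sub>L b \<in> A) \<and> id_blinfun \<in> A \<and> closed A"

definition unital_cstar_subalg :: "('a::chilbert \<Rightarrow>\<^sub>L 'a) set \<Rightarrow> bool" where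
  "unital_cstar_subalg A \<longleftrightarrow> unital_closed_subalg A \<and> (\<forall>a\<in>A. adjL a \<in> A)"

definition clinear_on :: "('a::chilbert \<Rightarrow>\<^sub>L 'a) set \<Rightarrow> (('a \<Rightarrow>\<^sub>L 'a) \<Rightarrow> complex) \<Rightarrow> bool" where
  "clinear_on A f \<longleftrightarrow> (\<forall>a\<in>A. \<forall>b\<in>A. f (a + b) = f a + f b) \<and> (\<forall>c. \<forall>a\<in>A. f (cscaleL c a) = c * f a)"

text \<open>character: nonzero multiplicative linear functional (values outside A irrelevant)\<close>
definition character :: "('a::chilbert \<Rightarrow>\<^sub>L 'a) set \<Rightarrow> (('a \<Rightarrow>\<^sub>L 'a) \<Rightarrow> complex) \<Rightarrow> bool" where
  "character A \<omega> \<longleftrightarrow> clinear_on A \<omega> \<and> (\<forall>a\<in>A. \<forall>b\<in>A. \<omega> (a o\<^sub>L b) = \<omega> a * \<omega> b) \<and> \<omega> id_blinfun = 1"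

definition state :: "('a::chilbert \<Rightarrow>\<^sub>L 'a) set \<Rightarrow> (('a \<Rightarrow>\<^sub>L 'a) \<Rightarrow> complex) \<Rightarrow> bool" where
  "state A \<psi> \<longleftrightarrow> clinear_on A \<psi> \<and>
     (\<forall>a\<in>A. Im (\<psi> (adjL a o\<^sub>L a)) = 0 \<and> Re (\<psi> (adjL a o\<^sub>L a)) \<ge> 0) \<and> \<psi> id_blinfun = 1"

definition pure_state :: "('a::chilbert \<Rightarrow>\<^sub>L 'a) set \<Rightarrow> (('a \<Rightarrow>\<^sub>L 'a) \<Rightarrow> complex) \<Rightarrow> bool" where
  "pure_state A \<psi> \<longleftrightarrow> state A \<psi> \<and>
     (\<forall>\<phi>1 \<phi>2 (l::real). state A \<phi>1 \<and> state A \<phi>2 \<and> 0 < l \<and> l < 1 \<and>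
        (\<forall>a\<in>A. \<psi> a = of_real l * \<phi>1 a + of_real (1 - l) * \<phi>2 a) \<longrightarrow> (\<forall>a\<in>A. \<phi>1 a = \<psi> a))"

definition pure_contraction :: "('a::chilbert \<Rightarrow>\<^sub>L 'a) \<Rightarrow> bool" where
  "pure_contraction t \<longleftrightarrow> norm t \<le> 1 \<and>
     (\<forall>\<xi>. (\<lambda>n. (blinfun_apply (adjL t) ^^ n) \<xi>) \<longlonglongrightarrow> 0)"

definition characteristic_sequence ::
  "('a::chilbert \<Rightarrow>\<^sub>L 'a) set \<Rightarrow> (('a \<Rightarrow>\<^sub>L 'a) \<Rightarrow> complex) \<Rightarrow> (nat \<Rightarrow> ('a \<Rightarrow>\<^sub>L 'a)) \<Rightarrow> bool" where
  "characteristic_sequence A \<psi> \<Delta> \<longleftrightarrow> (\<forall>n. \<Delta> n \<in> A) \<and> (\<forall>n. norm (\<Delta> n) = 1) \<and>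
     (\<lambda>n. \<psi> (\<Delta> n)) \<longlonglongrightarrow> 1 \<and>
     (\<forall>a\<in>A. limsup (\<lambda>n. ereal (norm (adjL (\<Delta> n) o\<^sub>L a o\<^sub>L \<Delta> n))) \<le> ereal (cmod (\<psi> a)))"

definition opsys_plus_K :: "('a::chilbert \<Rightarrow>\<^sub>L 'a) set \<Rightarrow> ('a \<Rightarrow>\<^sub>L 'a) set" where
  "opsys_plus_K B = {a + adjL b + k | a b k. a \<in> B \<and> b \<in> B \<and> k \<in> Kset}"

end

theory Submission
  imports Defs
begin

text \<open>A pure state \<open>\<psi>\<close> that does not vanish on some rank-one operator dominates a multiple of a
  vector functional, so it is a vector state and the constant sequence consisting of the rank-one
  projection works.  Otherwise \<open>\<psi>\<close> vanishes on the compact operators, hence on commutators, and a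
  pure state that is a trace is a character.  For its peaking element \<open>t\<close> the powers \<open>t\<^sup>n\<close> form a
  characteristic sequence: if \<open>\<psi>(b) = 0\<close> then the essential norms of \<open>b t\<^sup>m\<close> tend to zero, and the
  compact error is absorbed because \<open>t\<^sup>*\<^sup>n k \<rightarrow> 0\<close> in norm for compact \<open>k\<close>, by purity of \<open>t\<close>.

  The characters needed for the decay of \<open>b t\<^sup>m\<close> come from seminorms: if \<open>p\<close> is a submultiplicative
  seminorm with \<open>p(x\<^sup>2) = p(x)\<^sup>2\<close> and \<open>p(a) = 1\<close>, then so is \<open>x \<mapsto> lim p(x a\<^sup>m)\<close>, and it is
  invariant under multiplication by \<open>a\<close>.  Hence a minimal such seminorm is multiplicative, and a
  multiplicative seminorm is the modulus of a character by a version of the Gelfand-Mazur theorem.\<close>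

section \<open>Complex Hilbert spaces\<close>

lemma quadratic_nonneg_imp_discriminant_le:
  fixes a b c :: real
  assumes nonneg: "\<And>s. 0 \<le> a + 2 * s * b + s\<^sup>2 * c" and c: "0 \<le> c"
  shows "b\<^sup>2 \<le> a * c"
proof (cases "c = 0")
  case True
  have "b = 0"
  proof (rule ccontr)
    assume "b \<noteq> 0"
    then show False using nonneg[of "- (a + 1) / (2 * b)"] True by (simp add: field_simps)
  qed
  then show ?thesis using True by simp
next
  case False
  then have "a + 2 * (- b / c) * b + (- b / c)\<^sup>2 * c = (a * c - b\<^sup>2) / c"
    by (simp add: field_simps power2_eq_square)
  with nonneg[of "- b / c"] c False show ?thesis by (simp add: zero_le_divide_iff)
qed

lemma le_if_power2_le_mult:
  fixes x y :: real
  assumes "x\<^sup>2 \<le> x * y" "0 \<le> y"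
  shows "x \<le> y"
  using assms by (cases "x \<le> 0") (auto simp: power2_eq_square)

lemma Cauchy_if_dist_power2_le:
  fixes X :: "nat \<Rightarrow> 'a::metric_space"
  assumes f: "f \<longlonglongrightarrow> 0" and dist: "\<And>i n. (dist (X i) (X n))\<^sup>2 \<le> f i + f n"
  shows "Cauchy X"
proof (rule metric_CauchyI)
  fix e :: real assume e: "e > 0"
  then have "\<forall>\<^sub>F n in sequentially. f n < e\<^sup>2 / 2" by (intro order_tendstoD(2)[OF f]) simp
  then obtain N where N: "\<And>n. n \<ge> N \<Longrightarrow> f n < e\<^sup>2 / 2" by (auto simp: eventually_sequentially)
  have "dist (X i) (X n) < e" if "i \<ge> N" "n \<ge> N" for i n
  proof (rule power2_less_imp_less)
    show "(dist (X i) (X n))\<^sup>2 < e\<^sup>2" using dist[of i n] N[OF that(1)] N[OF that(2)] by linarith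
  qed (use e in simp)
  then show "\<exists>N. \<forall>i\<ge>N. \<forall>n\<ge>N. dist (X i) (X n) < e" by blast
qed

lemma complete_space_attains_Inf:
  fixes J :: "'a::complete_space \<Rightarrow> real"
  assumes cont: "continuous_on UNIV J" and bdd: "bdd_below (range J)"
    and close: "\<And>x y. (dist x y)\<^sup>2 \<le> C * ((J x - Inf (range J)) + (J y - Inf (range J)))"
  obtains z where "\<And>x. J z \<le> J x"
proof -
  define m where "m = Inf (range J)"
  have m_le: "m \<le> J x" for x unfolding m_def by (rule cInf_lower) (use bdd in auto)
  have "\<exists>x. J x < m + inverse (real (Suc n))" for n
    using cInf_lessD[of "range J" "m + inverse (real (Suc n))"] unfolding m_def by auto
  then obtain X where X: "\<And>n. J (X n) < m + inverse (real (Suc n))" by metis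
  have J_X: "(\<lambda>n. J (X n)) \<longlonglongrightarrow> m"
  proof (rule tendsto_sandwich)
    show "\<forall>\<^sub>F n in sequentially. m \<le> J (X n)" by (simp add: m_le)
    show "\<forall>\<^sub>F n in sequentially. J (X n) \<le> m + inverse (real (Suc n))"
      using X by (simp add: less_imp_le)
    show "(\<lambda>n. m + inverse (real (Suc n))) \<longlonglongrightarrow> m" by (rule LIMSEQ_inverse_real_of_nat_add)
  qed simp
  then have "(\<lambda>n. C * (J (X n) - m)) \<longlonglongrightarrow> C * (m - m)" by (intro tendsto_intros)
  moreover have "(dist (X i) (X n))\<^sup>2 \<le> C * (J (X i) - m) + C * (J (X n) - m)" for i n
    unfolding m_def by (rule close[unfolded distrib_left])
  ultimately have "Cauchy X" by (intro Cauchy_if_dist_power2_le) auto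
  then obtain z where "X \<longlonglongrightarrow> z" using Cauchy_convergent convergent_def by blast
  then have "(\<lambda>n. J (X n)) \<longlonglongrightarrow> J z" using cont by (simp add: continuous_on_tendsto_compose)
  then have "J z = m" using J_X by (rule LIMSEQ_unique)
  then show thesis using m_le by (intro that[of z]) simp
qed

text \<open>The representing vector minimises \<open>\<parallel>x\<parallel>\<^sup>2 - 2 f x\<close>; minimising sequences converge by the
  parallelogram law.\<close>

lemma riesz_representation_real:
  fixes f :: "'a::{real_inner,complete_space} \<Rightarrow> real"
  assumes "bounded_linear f"
  obtains y where "\<And>x. f x = inner x y"
proof -
  interpret f: bounded_linear f by fact
  define J where "J x = (norm x)\<^sup>2 - 2 * f x" for x
  obtain B where B: "\<And>x. \<bar>f x\<bar> \<le> norm x * B" using f.bounded by auto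
  have bdd: "bdd_below (range J)"
  proof (rule bdd_belowI2)
    fix x :: 'a
    have "0 \<le> (norm x - B)\<^sup>2" by simp
    then show "- (B\<^sup>2) \<le> J x" using B[of x] unfolding J_def power2_diff by (simp add: abs_le_iff)
  qed
  have cont: "continuous_on UNIV J"
    unfolding J_def by (intro continuous_intros f.continuous_on)
  have "(dist x y)\<^sup>2 \<le> 2 * ((J x - Inf (range J)) + (J y - Inf (range J)))" for x y
  proof -
    have "(norm (x - y))\<^sup>2 = 2 * J x + 2 * J y - 4 * J ((1/2) *\<^sub>R (x + y))"
      unfolding J_def power2_norm_eq_inner f.scaleR f.add
      by (simp add: inner_simps inner_commute algebra_simps)
    moreover have "Inf (range J) \<le> J ((1/2) *\<^sub>R (x + y))" by (rule cInf_lower) (use bdd in auto)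
    ultimately show ?thesis by (simp add: dist_norm)
  qed
  from complete_space_attains_Inf[OF cont bdd this] obtain y where min: "\<And>x. J y \<le> J x" by blast
  have "f x = inner x y" for x
  proof -
    have "0 \<le> 0 + 2 * s * (inner x y - f x) + s\<^sup>2 * (norm x)\<^sup>2" for s
    proof -
      have "J (y + s *\<^sub>R x) = J y + 2 * s * (inner x y - f x) + s\<^sup>2 * (norm x)\<^sup>2"
        unfolding J_def power2_norm_eq_inner f.scaleR f.add
        by (simp add: inner_simps inner_commute algebra_simps power2_eq_square)
      with min[of "y + s *\<^sub>R x"] show ?thesis by simp
    qed
    then have "(inner x y - f x)\<^sup>2 \<le> 0 * (norm x)\<^sup>2"
      by (rule quadratic_nonneg_imp_discriminant_le) simp
    then show ?thesis by simp
  qed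
  then show thesis by (rule that)
qed

lemma jmul_minus: "jmul (- x) = - jmul (x::'a::chilbert)"
  using jmul_scaleR[of "-1" x] by simp

lemma jmul_diff: "jmul (x - y) = jmul x - jmul (y::'a::chilbert)"
  using jmul_add[of x "- y"] by (simp add: jmul_minus)

lemma jmul_zero [simp]: "jmul 0 = (0::'a::chilbert)"
  using jmul_scaleR[of 0 0] by simp

lemmas jmul_simps = jmul_add jmul_diff jmul_minus jmul_scaleR jmul_jmul

lemma norm_jmul [simp]: "norm (jmul x) = norm (x::'a::chilbert)"
  by (simp add: norm_eq_sqrt_inner jmul_inner)

lemma inner_jmul_left: "inner (jmul x) y = - inner x (jmul (y::'a::chilbert))"
  using jmul_inner[of "jmul x" y] by (simp add: jmul_jmul)

lemma inner_jmul_self [simp]: "inner x (jmul x) = 0" for x :: "'a::chilbert"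
  using inner_jmul_left[of x x] by (simp add: inner_commute)

lemma bounded_linear_jmul [bounded_linear]: "bounded_linear (jmul :: 'a::chilbert \<Rightarrow> 'a)"
  by (rule bounded_linear_intro[where K=1]) (simp_all add: jmul_add jmul_scaleR)

definition cscale :: "complex \<Rightarrow> 'a::chilbert \<Rightarrow> 'a" (infixr \<open>*\<^sub>C\<close> 75) where
  "c *\<^sub>C x = Re c *\<^sub>R x + Im c *\<^sub>R jmul x"

lemma cscale_simps:
  "c *\<^sub>C (x + y) = c *\<^sub>C x + c *\<^sub>C y"
  "c *\<^sub>C (x - y) = c *\<^sub>C x - c *\<^sub>C y"
  "(c + d) *\<^sub>C x = c *\<^sub>C x + d *\<^sub>C x"
  "(c - d) *\<^sub>C x = c *\<^sub>C x - d *\<^sub>C x"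
  "(- c) *\<^sub>C x = - (c *\<^sub>C x)"
  "c *\<^sub>C d *\<^sub>C x = (c * d) *\<^sub>C x"
  "of_real r *\<^sub>C x = r *\<^sub>R x"
  "1 *\<^sub>C x = x"
  "0 *\<^sub>C x = 0"
  "jmul (c *\<^sub>C x) = c *\<^sub>C jmul x"
  by (simp_all add: cscale_def jmul_simps algebra_simps)

definition cinner :: "'a::chilbert \<Rightarrow> 'a \<Rightarrow> complex" where
  "cinner x y = Complex (inner x y) (inner x (jmul y))"

lemma cinner_commute: "cinner y x = cnj (cinner x y)"
  by (simp add: cinner_def complex_eq_iff inner_commute inner_jmul_left[of x y, symmetric])

lemma cinner_simps:
  shows cinner_add_left: "cinner (x + y) z = cinner x z + cinner y z"
    and cinner_cscale_left: "cinner (c *\<^sub>C x) z = c * cinner x z"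
    and cinner_scaleR_left: "cinner (r *\<^sub>R x) z = of_real r * cinner x z"
  by (simp_all add: cinner_def cscale_def complex_eq_iff inner_simps inner_jmul_left jmul_jmul)

lemma cinner_zero [simp]: "cinner 0 y = 0" "cinner x 0 = 0"
  by (simp_all add: cinner_def complex_eq_iff)

lemma cinner_cscale_right: "cinner x (c *\<^sub>C y) = cnj c * cinner x y"
  by (metis cinner_commute cinner_cscale_left complex_cnj_mult)

lemma cinner_self: "cinner x x = of_real ((norm x)\<^sup>2)"
  by (simp add: cinner_def complex_eq_iff power2_norm_eq_inner)

lemma norm_cscale [simp]: "norm (c *\<^sub>C x) = cmod c * norm x"
proof -
  have "of_real ((norm (c *\<^sub>C x))\<^sup>2) = c * cnj c * of_real ((norm x)\<^sup>2)"
    by (simp add: cinner_self[symmetric] cinner_simps cinner_cscale_right del: of_real_power)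
  also have "\<dots> = of_real ((cmod c * norm x)\<^sup>2)"
    by (simp only: power_mult_distrib of_real_mult complex_norm_square)
  finally have "(norm (c *\<^sub>C x))\<^sup>2 = (cmod c * norm x)\<^sup>2" unfolding of_real_eq_iff .
  then show ?thesis by (simp add: power2_eq_iff_nonneg)
qed

lemma complex_rotate_to_norm:
  obtains c where "cmod c = 1" "c * z = of_real (cmod z)"
proof
  show "cmod (cis (- Arg z)) = 1" by simp
  have "cis (- Arg z) * rcis (cmod z) (Arg z) = of_real (cmod z)" by (simp add: rcis_def cis_mult)
  then show "cis (- Arg z) * z = of_real (cmod z)" by (simp only: rcis_cmod_Arg)
qed

lemma cinner_Cauchy_Schwarz: "cmod (cinner x y) \<le> norm x * norm y"
proof -
  obtain c where c: "cmod c = 1" "c * cinner x y = of_real (cmod (cinner x y))"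
    by (rule complex_rotate_to_norm)
  then have "cinner (c *\<^sub>C x) y = of_real (cmod (cinner x y))" by (simp add: cinner_simps)
  then have "cmod (cinner x y) = inner (c *\<^sub>C x) y" by (simp add: cinner_def complex_eq_iff)
  also have "\<dots> \<le> norm (c *\<^sub>C x) * norm y" by (rule norm_cauchy_schwarz)
  finally show ?thesis by (simp add: c)
qed

lemma riesz_representation:
  fixes f :: "'a::chilbert \<Rightarrow> complex"
  assumes add: "\<And>x y. f (x + y) = f x + f y" and scale: "\<And>c x. f (c *\<^sub>C x) = c * f x"
    and bound: "\<And>x. cmod (f x) \<le> norm x * K"
  obtains y where "\<And>x. f x = cinner x y"
proof -
  have "bounded_linear (\<lambda>x. Re (f x))"
  proof (rule bounded_linear_intro)
    fix x and r :: real
    show "Re (f (r *\<^sub>R x)) = r *\<^sub>R Re (f x)"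
      using scale[of "of_real r" x] by (simp add: cscale_simps)
    show "norm (Re (f x)) \<le> norm x * K" using abs_Re_le_cmod[of "f x"] bound[of x] by simp
  qed (simp add: add)
  then obtain y where Re: "\<And>x. Re (f x) = inner x y" using riesz_representation_real by blast
  have "Im (f x) = inner x (jmul y)" for x
    using scale[of \<i> x] Re[of "\<i> *\<^sub>C x"] by (simp add: cscale_def inner_jmul_left)
  then have "f x = cinner x y" for x by (simp add: cinner_def complex_eq_iff Re)
  then show thesis by (rule that)
qed

section \<open>Bounded operators and their adjoints\<close>

interpretation blinfun_compose: bounded_bilinear "(o\<^sub>L)"
  by (rule bounded_bilinear_blinfun_compose)

lemma blinfun_compose_assoc: "(R o\<^sub>L S) o\<^sub>L T = R o\<^sub>L (S o\<^sub>L T)"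
  by (rule blinfun_eqI) simp

lemma blinfun_compose_id [simp]: "id_blinfun o\<^sub>L T = T" "T o\<^sub>L id_blinfun = T"
  by (rule blinfun_eqI; simp)+

lemmas compose_simps = blinfun_compose.bilinear_simps blinfun_compose_assoc

lemma norm_compose_contraction:
  assumes "norm S \<le> 1"
  shows "norm (S o\<^sub>L T) \<le> norm T" "norm (T o\<^sub>L S) \<le> norm T"
proof -
  show "norm (S o\<^sub>L T) \<le> norm T"
    using norm_blinfun_compose[of S T] assms mult_right_mono[of "norm S" 1 "norm T"] by simp
  show "norm (T o\<^sub>L S) \<le> norm T"
    using norm_blinfun_compose[of T S] assms mult_left_mono[of "norm S" 1 "norm T"] by simp
qed

lemma norm_blinfun_le_on_unit_ball:
  assumes "\<And>x. norm x < 1 \<Longrightarrow> norm (blinfun_apply T x) \<le> c"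
  shows "norm T \<le> c"
proof (rule norm_blinfun_bound)
  show "0 \<le> c" using assms[of 0] by simp
  show "norm (T x) \<le> c * norm x" for x
  proof (rule field_le_mult_one_interval)
    fix r :: real assume "0 < r" "r < 1"
    then show "r * norm (T x) \<le> c * norm x"
      using assms[of "(r / norm x) *\<^sub>R x"]
      by (cases "x = 0") (auto simp: blinfun.bilinear_simps field_simps)
  qed
qed

primrec opow :: "('a::real_normed_vector \<Rightarrow>\<^sub>L 'a) \<Rightarrow> nat \<Rightarrow> ('a \<Rightarrow>\<^sub>L 'a)" where
  "opow T 0 = id_blinfun"
| "opow T (Suc n) = T o\<^sub>L opow T n"

lemma opow_add: "opow T (m + n) = opow T m o\<^sub>L opow T n"
  by (induction m) (auto simp: compose_simps)

lemma opow_Suc_right: "opow T (Suc n) = opow T n o\<^sub>L T"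
  using opow_add[of T n 1] by simp

lemma opow_apply: "blinfun_apply (opow T n) x = (blinfun_apply T ^^ n) x"
  by (induction n) auto

lemma norm_opow_le_1:
  assumes "norm T \<le> 1"
  shows "norm (opow T n) \<le> 1"
proof (induction n)
  case (Suc n)
  then show ?case using norm_compose_contraction(1)[OF assms, of "opow T n"] by simp
qed (simp add: norm_blinfun_id_le)

lemma jop_apply [simp]: "blinfun_apply jop x = jmul x"
  unfolding jop_def by (simp add: bounded_linear_Blinfun_apply bounded_linear_jmul)

lemma cscaleL_apply [simp]: "blinfun_apply (cscaleL c T) x = c *\<^sub>C blinfun_apply T x"
  by (simp add: cscaleL_def cscale_def blinfun.bilinear_simps)

abbreviation scalar :: "complex \<Rightarrow> ('a::chilbert \<Rightarrow>\<^sub>L 'a)" where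
  "scalar c \<equiv> cscaleL c id_blinfun"

lemma cscaleL_simps:
  shows cscaleL_add_right: "cscaleL c (S + T) = cscaleL c S + cscaleL c T"
    and cscaleL_diff_right: "cscaleL c (S - T) = cscaleL c S - cscaleL c T"
    and cscaleL_add_left: "cscaleL (c + d) T = cscaleL c T + cscaleL d T"
    and cscaleL_diff_left: "cscaleL (c - d) T = cscaleL c T - cscaleL d T"
    and cscaleL_minus_left: "cscaleL (- c) T = - cscaleL c T"
    and cscaleL_cscaleL: "cscaleL c (cscaleL d T) = cscaleL (c * d) T"
    and cscaleL_of_real: "cscaleL (of_real r) T = r *\<^sub>R T"
    and cscaleL_one: "cscaleL 1 T = T"
    and cscaleL_zero: "cscaleL 0 T = 0"
    and cscaleL_compose: "cscaleL c S o\<^sub>L T = cscaleL c (S o\<^sub>L T)"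
  by (rule blinfun_eqI; simp add: blinfun.bilinear_simps cscale_simps)+

lemma cscaleL_homogeneous_if_le:
  assumes le: "\<And>c T. N (cscaleL c T) \<le> cmod c * N T" and nonneg: "\<And>T. (0::real) \<le> N T"
  shows "N (cscaleL c T) = cmod c * N T"
proof (cases "c = 0")
  case True
  then show ?thesis using le[of c T] nonneg[of "cscaleL c T"] by simp
next
  case False
  have "N T \<le> cmod (1 / c) * N (cscaleL c T)"
    using le[of "1 / c" "cscaleL c T"] False by (simp add: cscaleL_simps)
  then have "cmod c * N T \<le> N (cscaleL c T)" using False by (simp add: norm_divide field_simps)
  then show ?thesis using le[of c T] by simp
qed

lemma norm_cscaleL_le: "norm (cscaleL c T) \<le> cmod c * norm T"
  by (rule norm_blinfun_bound) (auto simp: norm_blinfun mult.assoc intro: mult_left_mono)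

lemma norm_cscaleL [simp]: "norm (cscaleL c T) = cmod c * norm T"
  by (rule cscaleL_homogeneous_if_le) (simp_all add: norm_cscaleL_le)

lemma BH_apply_jmul: "T \<in> BH \<Longrightarrow> blinfun_apply T (jmul x) = jmul (blinfun_apply T x)"
  by (simp add: BH_def clinear_op_def)

lemma BH_apply_cscale: "T \<in> BH \<Longrightarrow> blinfun_apply T (c *\<^sub>C x) = c *\<^sub>C blinfun_apply T x"
  by (simp add: cscale_def blinfun.bilinear_simps BH_apply_jmul)

lemma BH_compose_cscaleL: "S \<in> BH \<Longrightarrow> S o\<^sub>L cscaleL c T = cscaleL c (S o\<^sub>L T)"
  by (rule blinfun_eqI) (simp add: BH_apply_cscale)

lemma norm_le_of_adjoint:
  fixes T :: "'a::real_inner \<Rightarrow>\<^sub>L 'b::real_inner"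
  assumes "\<And>x y. inner (blinfun_apply T x) y = inner x (s y)"
  shows "norm (s y) \<le> norm T * norm y"
proof (rule le_if_power2_le_mult)
  have "(norm (s y))\<^sup>2 = inner (T (s y)) y" by (simp add: assms power2_norm_eq_inner)
  also have "\<dots> \<le> norm (T (s y)) * norm y" by (rule norm_cauchy_schwarz)
  also have "\<dots> \<le> norm T * norm (s y) * norm y" by (intro mult_right_mono norm_blinfun) auto
  finally show "(norm (s y))\<^sup>2 \<le> norm (s y) * (norm T * norm y)" by (simp add: mult_ac)
qed simp

lemma adjoint_exists:
  fixes T :: "'a::{real_inner,complete_space} \<Rightarrow>\<^sub>L 'b::real_inner"
  obtains S :: "'b \<Rightarrow>\<^sub>L 'a" where "\<And>x y. inner (blinfun_apply T x) y = inner x (blinfun_apply S y)"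
proof -
  have "\<exists>z. \<forall>x. inner (blinfun_apply T x) y = inner x z" for y
    using riesz_representation_real[OF
        bounded_linear_compose[OF bounded_linear_inner_left blinfun.bounded_linear_right]] by metis
  then obtain s where s: "\<And>x y. inner (blinfun_apply T x) y = inner x (s y)" by metis
  have "bounded_linear s"
  proof (rule bounded_linear_intro)
    fix x y :: 'b and r :: real
    show "s (x + y) = s x + s y"
      by (subst vector_eq_ldot[symmetric]) (simp add: inner_simps flip: s)
    show "s (r *\<^sub>R x) = r *\<^sub>R s x"
      by (subst vector_eq_ldot[symmetric]) (simp add: inner_simps flip: s)
    show "norm (s x) \<le> norm x * norm T"
      using norm_le_of_adjoint[OF s, of x] by (simp add: mult.commute)
  qed
  then show thesis using that[of "Blinfun s"] s by (simp add: bounded_linear_Blinfun_apply)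
qed

lemma adjL_eqI:
  assumes "\<And>x y. inner (blinfun_apply T x) y = inner x (blinfun_apply S y)"
  shows "adjL T = S"
  unfolding adjL_def
proof (rule the_equality)
  fix R assume "\<forall>x y. inner (blinfun_apply T x) y = inner x (blinfun_apply R y)"
  then show "R = S" using assms by (intro blinfun_eqI) (metis vector_eq_ldot)
qed (use assms in blast)

lemma inner_adjL: "inner (blinfun_apply T x) y = inner x (blinfun_apply (adjL T) y)"
  using adjoint_exists[of T] adjL_eqI[of T] by metis

lemma inner_adjL': "inner x (blinfun_apply T y) = inner (blinfun_apply (adjL T) x) y"
  using inner_adjL[of T y x] by (simp add: inner_commute)

lemma adjL_simps [simp]:
  "adjL (S + T) = adjL S + adjL T"
  "adjL (S - T) = adjL S - adjL T"
  "adjL (r *\<^sub>R T) = r *\<^sub>R adjL T"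
  "adjL (adjL T) = T"
  "adjL id_blinfun = id_blinfun"
  "adjL 0 = 0"
  by (rule adjL_eqI; simp add: inner_simps blinfun.bilinear_simps inner_adjL inner_adjL'[of _ T])+

lemma adjL_compose: "adjL (S o\<^sub>L T) = adjL T o\<^sub>L adjL S"
  by (rule adjL_eqI) (simp add: inner_adjL)

lemma conjugate_adjL_compose: "adjL S o\<^sub>L (adjL T o\<^sub>L T) o\<^sub>L S = adjL (T o\<^sub>L S) o\<^sub>L (T o\<^sub>L S)"
  by (simp add: adjL_compose blinfun_compose_assoc)

lemma adjL_opow: "adjL (opow T n) = opow (adjL T) n"
  by (induction n) (simp_all add: adjL_compose flip: opow_Suc_right)

lemma adjL_BH: "T \<in> BH \<Longrightarrow> adjL T \<in> BH"
  unfolding BH_def clinear_op_def mem_Collect_eq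
proof
  fix x assume T: "\<forall>x. blinfun_apply T (jmul x) = jmul (blinfun_apply T x)"
  have "inner z (adjL T (jmul x)) = inner z (jmul (adjL T x))" for z
  proof -
    have "inner z (adjL T (jmul x)) = - inner (jmul (T z)) x"
      by (simp add: inner_jmul_left flip: inner_adjL)
    also have "\<dots> = - inner (jmul z) (adjL T x)" using T by (simp flip: inner_adjL)
    finally show ?thesis by (simp add: inner_jmul_left)
  qed
  then show "adjL T (jmul x) = jmul (adjL T x)" using vector_eq_ldot by blast
qed

lemma cinner_adjL: "T \<in> BH \<Longrightarrow> cinner (blinfun_apply T x) y = cinner x (blinfun_apply (adjL T) y)"
  by (simp add: cinner_def inner_adjL BH_apply_jmul adjL_BH)

lemma adjL_cscaleL: "T \<in> BH \<Longrightarrow> adjL (cscaleL c T) = cscaleL (cnj c) (adjL T)"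
  by (rule adjL_eqI)
    (simp add: cscale_def inner_simps blinfun.bilinear_simps inner_adjL inner_jmul_left
      BH_apply_jmul adjL_BH)

lemma norm_adjL [simp]: "norm (adjL T) = norm T"
proof -
  have "norm (adjL S) \<le> norm S" for S :: "'a \<Rightarrow>\<^sub>L 'a"
    by (rule norm_blinfun_bound) (auto intro: norm_le_of_adjoint inner_adjL)
  from this[of T] this[of "adjL T"] show ?thesis by simp
qed

lemma bounded_linear_adjL: "bounded_linear adjL"
  by (rule bounded_linear_intro[where K=1]) simp_all

lemma norm_adjL_compose: "norm (adjL T o\<^sub>L T) = (norm T)\<^sup>2"
proof (rule antisym)
  show "norm (adjL T o\<^sub>L T) \<le> (norm T)\<^sup>2"
    using norm_blinfun_compose[of "adjL T" T] by (simp add: power2_eq_square)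
  let ?M = "norm (adjL T o\<^sub>L T)"
  have "norm T \<le> sqrt ?M"
  proof (rule norm_blinfun_bound)
    fix y
    have "(norm (T y))\<^sup>2 = inner y ((adjL T o\<^sub>L T) y)"
      by (simp add: power2_norm_eq_inner inner_adjL)
    also have "\<dots> \<le> norm y * norm ((adjL T o\<^sub>L T) y)" by (rule norm_cauchy_schwarz)
    also have "\<dots> \<le> norm y * (?M * norm y)" by (intro mult_left_mono norm_blinfun) auto
    also have "\<dots> = (sqrt ?M * norm y)\<^sup>2" by (simp add: power_mult_distrib power2_eq_square)
    finally show "norm (T y) \<le> sqrt ?M * norm y" by (rule power2_le_imp_le) simp
  qed simp
  then have "(norm T)\<^sup>2 \<le> (sqrt ?M)\<^sup>2" by (intro power_mono) auto
  then show "(norm T)\<^sup>2 \<le> ?M" by simp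
qed

lemma norm_compose_adjL: "norm (T o\<^sub>L adjL T) = (norm T)\<^sup>2"
  using norm_adjL_compose[of "adjL T"] by simp

section \<open>Operator algebras\<close>

lemma complex_subspace_imp_subspace: "complex_subspace A \<Longrightarrow> subspace A"
  unfolding subspace_def complex_subspace_def by (metis cscaleL_of_real)

locale unital_operator_algebra =
  fixes AA :: "('h::chilbert \<Rightarrow>\<^sub>L 'h) set"
  assumes subset_BH: "AA \<subseteq> BH" and complex_subspace: "complex_subspace AA"
    and compose_closed: "\<And>a b. a \<in> AA \<Longrightarrow> b \<in> AA \<Longrightarrow> a o\<^sub>L b \<in> AA"
    and id_closed: "id_blinfun \<in> AA"
begin

lemma in_BH: "a \<in> AA \<Longrightarrow> a \<in> BH"
  using subset_BH by blast

lemma subspace: "subspace AA"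
  by (rule complex_subspace_imp_subspace[OF complex_subspace])

lemma cscaleL_closed: "a \<in> AA \<Longrightarrow> cscaleL c a \<in> AA"
  using complex_subspace by (simp add: complex_subspace_def)

lemma opow_closed: "a \<in> AA \<Longrightarrow> opow a n \<in> AA"
  by (induction n) (auto intro: id_closed compose_closed)

lemmas closed_intros =
  subspace_0[OF subspace] subspace_add[OF subspace] subspace_diff[OF subspace]
  subspace_neg[OF subspace] subspace_scale[OF subspace]
  cscaleL_closed compose_closed id_closed opow_closed

end

lemma unital_closed_subalg_imp_operator_algebra:
  "unital_closed_subalg A \<Longrightarrow> unital_operator_algebra A"
  by (simp add: unital_closed_subalg_def unital_operator_algebra_def)

interpretation BH: unital_operator_algebra BH
  by unfold_locales
    (auto simp: complex_subspace_def BH_def clinear_op_def blinfun.bilinear_simps jmul_simps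
      cscale_simps)

section \<open>Compact operators\<close>

lemma compact_opI:
  assumes "compact C" "\<And>x. norm x < 1 \<Longrightarrow> blinfun_apply T x \<in> C"
  shows "compact_op T"
proof -
  have "closure (T ` ball 0 1) \<subseteq> C"
    by (rule closure_minimal) (use assms in \<open>auto intro: compact_imp_closed\<close>)
  then show ?thesis unfolding compact_op_def
    by (metis assms(1) closed_closure compact_Int_closed inf.absorb2)
qed

lemma in_closure_image_unit_ball: "norm x < 1 \<Longrightarrow> blinfun_apply T x \<in> closure (T ` ball 0 1)"
  by (intro subsetD[OF closure_subset] imageI) simp

lemma compact_op_add:
  assumes "compact_op k" "compact_op l"
  shows "compact_op (k + l)"
  by (rule compact_opI[OF compact_sums[OF assms[unfolded compact_op_def]]])
    (use in_closure_image_unit_ball[of _ k] in_closure_image_unit_ball[of _ l]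
      in \<open>auto simp: blinfun.bilinear_simps\<close>)

lemma compact_op_compose_left:
  assumes "compact_op k"
  shows "compact_op (a o\<^sub>L k)"
proof (rule compact_opI)
  show "compact (a ` closure (k ` ball 0 1))"
    using assms unfolding compact_op_def
    by (intro compact_continuous_image linear_continuous_on blinfun.bounded_linear_right) auto
qed (use in_closure_image_unit_ball[of _ k] in auto)

lemma compact_op_compose_right:
  assumes "compact_op k"
  shows "compact_op (k o\<^sub>L a)"
proof (rule compact_opI)
  define r where "r = norm a + 1"
  have r: "r > 0" by (simp add: r_def add_nonneg_pos)
  show "compact ((*\<^sub>R) r ` closure (k ` ball 0 1))"
    using assms unfolding compact_op_def by (rule compact_scaling)
  fix x :: 'a assume x: "norm x < 1"
  have "norm (a x) \<le> norm a * norm x" by (rule norm_blinfun)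
  also have "\<dots> < r" using x mult_left_le[of "norm x" "norm a"] by (simp add: r_def)
  finally have "norm ((1/r) *\<^sub>R a x) < 1" using r by simp
  then have "r *\<^sub>R k ((1/r) *\<^sub>R a x) \<in> (*\<^sub>R) r ` closure (k ` ball 0 1)"
    by (intro imageI in_closure_image_unit_ball)
  then show "(k o\<^sub>L a) x \<in> (*\<^sub>R) r ` closure (k ` ball 0 1)"
    using r by (simp add: blinfun.bilinear_simps)
qed

lemma compact_op_finite_net:
  assumes "compact_op k" "e > 0"
  obtains S where "finite S" "\<And>x. norm x < 1 \<Longrightarrow> \<exists>s\<in>S. norm (blinfun_apply k x - s) < e"
proof -
  obtain S where S: "finite S" "closure (k ` ball 0 1) \<subseteq> (\<Union>x\<in>S. ball x e)"
    using assms unfolding compact_op_def compact_eq_totally_bounded by meson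
  show thesis
  proof (rule that[OF S(1)])
    fix x :: 'a assume "norm x < 1"
    then show "\<exists>s\<in>S. norm (k x - s) < e" using S(2) in_closure_image_unit_ball[of x k]
      by (force simp: dist_norm norm_minus_commute)
  qed
qed

lemma strong_null_compose_compact_op:
  assumes k: "compact_op k" and bound: "\<And>n. norm (S n) \<le> B"
    and null: "\<And>x. (\<lambda>n. blinfun_apply (S n) x) \<longlonglongrightarrow> 0"
  shows "(\<lambda>n. S n o\<^sub>L k) \<longlonglongrightarrow> 0"
proof (rule tendstoI)
  fix e :: real assume e: "e > 0"
  have B: "0 \<le> B" using norm_ge_zero[of "S 0"] bound[of 0] by linarith
  define d where "d = e / (2 * (B + 1))"
  have d: "d > 0" "B * d \<le> e/2" using e B by (auto simp: d_def field_simps)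
  obtain F where F: "finite F" "\<And>x. norm x < 1 \<Longrightarrow> \<exists>s\<in>F. norm (k x - s) < d"
    using compact_op_finite_net[OF k d(1)] by blast
  have "\<forall>\<^sub>F n in sequentially. \<forall>s\<in>F. norm (S n s) < e/4"
  proof (intro eventually_ball_finite ballI F(1))
    fix s
    show "\<forall>\<^sub>F n in sequentially. norm (S n s) < e/4"
      using tendstoD[OF null[of s], of "e/4"] e by (simp add: dist_norm)
  qed
  then show "\<forall>\<^sub>F n in sequentially. dist (S n o\<^sub>L k) 0 < e"
  proof eventually_elim
    case (elim n)
    have "norm (S n o\<^sub>L k) \<le> e/2 + e/4"
    proof (rule norm_blinfun_le_on_unit_ball)
      fix x :: 'a assume "norm x < 1"
      then obtain s where s: "s \<in> F" "norm (k x - s) < d" using F(2) by blast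
      have "norm (S n (k x - s)) \<le> norm (S n) * norm (k x - s)" by (rule norm_blinfun)
      also have "\<dots> \<le> B * d" using s B by (intro mult_mono bound) auto
      finally have "norm (S n (k x - s)) \<le> e/2" using d(2) by linarith
      moreover have "norm (S n s) \<le> e/4" using elim s(1) by (simp add: less_imp_le)
      moreover have "(S n o\<^sub>L k) x = S n (k x - s) + S n s" by (simp add: blinfun.bilinear_simps)
      ultimately show "norm ((S n o\<^sub>L k) x) \<le> e/2 + e/4" by (metis add_mono norm_triangle_mono)
    qed
    then show ?case using e by (simp add: dist_norm)
  qed
qed

lemma Kset_BH: "k \<in> Kset \<Longrightarrow> k \<in> BH"
  by (simp add: Kset_def)

lemma Kset_compose_left: "a \<in> BH \<Longrightarrow> k \<in> Kset \<Longrightarrow> a o\<^sub>L k \<in> Kset"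
  by (simp add: Kset_def BH.compose_closed compact_op_compose_left)

lemma Kset_compose_right: "a \<in> BH \<Longrightarrow> k \<in> Kset \<Longrightarrow> k o\<^sub>L a \<in> Kset"
  by (simp add: Kset_def BH.compose_closed compact_op_compose_right)

lemma complex_subspace_Kset: "complex_subspace Kset"
proof -
  have "cscaleL c k \<in> Kset" if "k \<in> Kset" for c and k :: "'a::chilbert \<Rightarrow>\<^sub>L 'a"
    using Kset_compose_left[of "scalar c" k] that by (simp add: BH.closed_intros cscaleL_simps)
  moreover have "compact_op 0" by (rule compact_opI[of "{0}"]) auto
  ultimately show ?thesis
    by (auto simp: complex_subspace_def) (auto simp: Kset_def BH.closed_intros compact_op_add)
qed

lemmas subspace_Kset = complex_subspace_imp_subspace[OF complex_subspace_Kset]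

lemma Kset_cscaleL: "k \<in> Kset \<Longrightarrow> cscaleL c k \<in> Kset"
  using complex_subspace_Kset unfolding complex_subspace_def by blast

definition rank1 :: "'a::chilbert \<Rightarrow> 'a \<Rightarrow> 'a \<Rightarrow>\<^sub>L 'a" where
  "rank1 v e = Blinfun (\<lambda>x. cinner x e *\<^sub>C v)"

lemma rank1_apply [simp]: "blinfun_apply (rank1 v e) x = cinner x e *\<^sub>C v"
proof -
  have "bounded_linear (\<lambda>x. cinner x e *\<^sub>C v)"
    unfolding cinner_def cscale_def complex.sel by (intro bounded_linear_intros)
  then show ?thesis by (simp add: rank1_def bounded_linear_Blinfun_apply)
qed

lemma norm_rank1_le: "norm (rank1 v e) \<le> norm v * norm e"
proof (rule norm_blinfun_bound)
  fix x
  show "norm (rank1 v e x) \<le> norm v * norm e * norm x"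
    using mult_right_mono[OF cinner_Cauchy_Schwarz[of x e], of "norm v"] by (simp add: mult_ac)
qed simp

lemma compose_rank1: "a \<in> BH \<Longrightarrow> a o\<^sub>L rank1 v e = rank1 (blinfun_apply a v) e"
  by (rule blinfun_eqI) (simp add: BH_apply_cscale)

lemma rank1_compose: "a \<in> BH \<Longrightarrow> rank1 v e o\<^sub>L a = rank1 v (blinfun_apply (adjL a) e)"
  by (rule blinfun_eqI) (simp add: cinner_adjL)

lemma adjL_rank1 [simp]: "adjL (rank1 v e) = rank1 e v"
  by (rule adjL_eqI) (simp add: cscale_def cinner_def inner_simps inner_commute mult.commute)

lemma rank1_add: "rank1 (v + w) e = rank1 v e + rank1 w e"
  by (rule blinfun_eqI) (simp add: blinfun.bilinear_simps cscale_simps)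

lemma rank1_cscale: "rank1 (c *\<^sub>C v) e = cscaleL c (rank1 v e)"
  by (rule blinfun_eqI) (simp add: cscale_simps mult.commute)

lemma rank1_zero [simp]: "rank1 0 e = 0" "rank1 v 0 = 0"
  by (rule blinfun_eqI; simp add: cscale_def)+

lemma rank1_BH: "rank1 v e \<in> BH"
  by (simp add: BH_def clinear_op_def)
    (simp add: cscale_def cinner_def jmul_simps jmul_inner inner_jmul_left)

lemma rank1_Kset: "rank1 v e \<in> Kset"
proof -
  have "compact ((\<lambda>c. c *\<^sub>C v) ` cball 0 (norm e))"
    unfolding cscale_def by (intro compact_continuous_image compact_cball continuous_intros)
  then have "compact_op (rank1 v e)"
  proof (rule compact_opI)
    fix x :: 'a assume x: "norm x < 1"
    have "cmod (cinner x e) \<le> norm x * norm e" by (rule cinner_Cauchy_Schwarz)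
    also have "\<dots> \<le> norm e" using x by (simp add: mult_left_le_one_le)
    finally show "rank1 v e x \<in> (\<lambda>c. c *\<^sub>C v) ` cball 0 (norm e)" by simp
  qed
  then show ?thesis by (simp add: Kset_def rank1_BH)
qed

definition finite_rank :: "('a::chilbert \<Rightarrow>\<^sub>L 'a) set" where
  "finite_rank = span {rank1 v e | v e. True}"

lemma subspace_finite_rank: "subspace finite_rank"
  by (simp add: finite_rank_def)

lemma rank1_finite_rank: "rank1 v e \<in> finite_rank"
  unfolding finite_rank_def by (rule span_base) blast

lemma finite_rank_subset:
  assumes "subspace S" "\<And>v e. rank1 v e \<in> S"
  shows "finite_rank \<subseteq> S"
  unfolding finite_rank_def by (rule span_minimal) (use assms in auto)

lemma finite_rank_Kset: "T \<in> finite_rank \<Longrightarrow> T \<in> Kset"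
  using finite_rank_subset[OF subspace_Kset] rank1_Kset by blast

lemma finite_rank_compose:
  assumes T: "T \<in> finite_rank" and a: "a \<in> BH"
  shows "T o\<^sub>L a \<in> finite_rank"
proof -
  have "subspace {T. T o\<^sub>L a \<in> finite_rank}"
    using subspace_finite_rank by (auto simp: subspace_def compose_simps)
  then have "finite_rank \<subseteq> {T. T o\<^sub>L a \<in> finite_rank}"
    by (rule finite_rank_subset) (simp add: rank1_compose[OF a] rank1_finite_rank)
  then show ?thesis using T by blast
qed

definition orthogonal_projection :: "('a::chilbert \<Rightarrow>\<^sub>L 'a) \<Rightarrow> bool" where
  "orthogonal_projection P \<longleftrightarrow> adjL P = P \<and> P o\<^sub>L P = P"

lemma norm_id_minus_orthogonal_projection:
  assumes "orthogonal_projection P"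
  shows "norm (id_blinfun - P) \<le> 1"
proof -
  let ?Q = "id_blinfun - P"
  have "adjL ?Q o\<^sub>L ?Q = ?Q" using assms by (simp add: orthogonal_projection_def compose_simps)
  then have "(norm ?Q)\<^sup>2 \<le> norm ?Q * 1" using norm_adjL_compose[of ?Q] by simp
  then show ?thesis by (rule le_if_power2_le_mult) simp
qed

lemma orthogonal_projection_add_rank1:
  assumes P: "orthogonal_projection P" "P \<in> BH" and u: "norm u = 1" "blinfun_apply P u = 0"
  shows "orthogonal_projection (P + rank1 u u)"
  using assms
  by (simp add: orthogonal_projection_def compose_simps compose_rank1 rank1_compose
      rank1_BH cinner_self cscale_simps)

lemma finite_rank_projection_extend:
  assumes P: "P \<in> finite_rank" "orthogonal_projection P"
  obtains R where "R \<in> finite_rank" "orthogonal_projection R" "blinfun_apply R s = s"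
    "\<And>x. blinfun_apply P x = x \<Longrightarrow> blinfun_apply R x = x"
proof -
  have P_BH: "P \<in> BH" using P(1) finite_rank_Kset Kset_BH by blast
  define w where "w = s - P s"
  show thesis
  proof (cases "w = 0")
    case True
    then show thesis using P by (intro that[of P]) (auto simp: w_def)
  next
    case False
    define u where "u = (1 / norm w) *\<^sub>R w"
    have u: "norm u = 1" and w: "w = norm w *\<^sub>R u" using False by (auto simp: u_def)
    have "P (P s) = P s"
      using P(2) by (metis blinfun_apply_blinfun_compose orthogonal_projection_def)
    then have Pu: "P u = 0" by (simp add: u_def w_def blinfun.bilinear_simps)
    have orth: "cinner (P x) u = 0" for x
      using cinner_adjL[OF P_BH, of x u] P(2) Pu by (simp add: orthogonal_projection_def)
    show thesis
    proof (rule that)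
      show "P + rank1 u u \<in> finite_rank"
        by (intro subspace_add[OF subspace_finite_rank] P rank1_finite_rank)
      show "orthogonal_projection (P + rank1 u u)"
        by (rule orthogonal_projection_add_rank1[OF P(2) P_BH u Pu])
      show "(P + rank1 u u) x = x" if "P x = x" for x
        using orth[of x] that by (simp add: blinfun.bilinear_simps cscale_simps)
      have "cinner s u = cinner (P s) u + cinner w u" by (simp add: w_def flip: cinner_simps)
      also have "\<dots> = of_real (norm w)" by (subst w) (simp add: orth cinner_simps cinner_self u)
      finally have "rank1 u u s = w" using w by (simp add: cscale_simps)
      then show "(P + rank1 u u) s = s" by (simp add: blinfun.bilinear_simps w_def)
    qed
  qed
qed

lemma finite_rank_projection_fixing:
  assumes "finite S"
  obtains P where "P \<in> finite_rank" "orthogonal_projection P" "\<And>s. s \<in> S \<Longrightarrow> blinfun_apply P s = s"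
  using assms
proof (induction S arbitrary: thesis rule: finite_induct)
  case empty
  show ?case
    by (rule empty.prems[of 0])
      (auto simp: orthogonal_projection_def subspace_0[OF subspace_finite_rank])
next
  case (insert s S)
  obtain P where P: "P \<in> finite_rank" "orthogonal_projection P" "\<And>x. x \<in> S \<Longrightarrow> P x = x"
    using insert.IH by blast
  obtain R where "R \<in> finite_rank" "orthogonal_projection R" "R s = s" "\<And>x. P x = x \<Longrightarrow> R x = x"
    using finite_rank_projection_extend[OF P(1,2)] by blast
  then show ?case using P(3) by (intro insert.prems[of R]) auto
qed

lemma Kset_finite_rank_approx:
  assumes "k \<in> Kset" "e > 0"
  obtains P where "P \<in> finite_rank" "orthogonal_projection P" "norm (k - (P o\<^sub>L k)) \<le> e"
proof -
  obtain S where S: "finite S" "\<And>x. norm x < 1 \<Longrightarrow> \<exists>s\<in>S. norm (k x - s) < e"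
    using compact_op_finite_net assms unfolding Kset_def by blast
  obtain P where P: "P \<in> finite_rank" "orthogonal_projection P" "\<And>s. s \<in> S \<Longrightarrow> P s = s"
    using finite_rank_projection_fixing[OF S(1)] by blast
  have "norm (k - (P o\<^sub>L k)) \<le> e"
  proof (rule norm_blinfun_le_on_unit_ball)
    fix x :: 'a assume "norm x < 1"
    then obtain s where s: "s \<in> S" "norm (k x - s) < e" using S(2) by blast
    have "(k - (P o\<^sub>L k)) x = (id_blinfun - P) (k x - s)"
      using P(3) s(1) by (simp add: blinfun.bilinear_simps)
    also have "norm \<dots> \<le> norm (id_blinfun - P) * norm (k x - s)" by (rule norm_blinfun)
    also have "\<dots> \<le> 1 * norm (k x - s)"
      by (intro mult_right_mono norm_id_minus_orthogonal_projection P) auto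
    finally show "norm ((k - (P o\<^sub>L k)) x) \<le> e" using s by simp
  qed
  then show thesis using that P(1,2) by blast
qed

section \<open>The essential norm\<close>

definition essnorm :: "('a::chilbert \<Rightarrow>\<^sub>L 'a) \<Rightarrow> real" where
  "essnorm T = infdist T Kset"

lemma essnorm_le: "k \<in> Kset \<Longrightarrow> essnorm T \<le> norm (T + k)"
  using infdist_le[of "- k" Kset T]
  by (simp add: essnorm_def dist_norm subspace_neg[OF subspace_Kset])

lemma essnorm_le_norm: "essnorm T \<le> norm T"
  using essnorm_le[of 0 T] subspace_0[OF subspace_Kset] by simp

lemma essnorm_nonneg [simp]: "0 \<le> essnorm T"
  by (simp add: essnorm_def infdist_nonneg)

lemma essnorm_Kset: "k \<in> Kset \<Longrightarrow> essnorm k = 0"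
  by (simp add: essnorm_def)

lemma le_essnormI:
  assumes "\<And>k. k \<in> Kset \<Longrightarrow> c \<le> norm (T + k)"
  shows "c \<le> essnorm T"
proof -
  have ne: "Kset \<noteq> {}" using subspace_0[OF subspace_Kset] by blast
  have "c \<le> dist T k" if "k \<in> Kset" for k
    using assms[OF subspace_neg[OF subspace_Kset that]] by (simp add: dist_norm)
  then show ?thesis unfolding essnorm_def infdist_notempty[OF ne] by (intro cINF_greatest ne)
qed

lemma le_mult_essnormI:
  assumes "0 \<le> b" "\<And>k. k \<in> Kset \<Longrightarrow> c \<le> b * norm (T + k)"
  shows "c \<le> b * essnorm T"
proof (cases "b = 0")
  case True
  then show ?thesis using assms(2)[OF subspace_0[OF subspace_Kset]] by simp
next
  case False
  then have "c / b \<le> essnorm T" using assms by (intro le_essnormI) (simp add: field_simps)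
  then show ?thesis using False assms(1) by (simp add: field_simps)
qed

lemma essnorm_lessD: "essnorm T < c \<Longrightarrow> \<exists>k\<in>Kset. norm (T + k) < c"
  using le_essnormI[of c T] by force

lemma essnorm_add: "essnorm (S + T) \<le> essnorm S + essnorm T"
proof -
  have "essnorm (S + T) - norm (S + k) \<le> essnorm T" if k: "k \<in> Kset" for k
  proof (rule le_essnormI)
    fix l :: "'a \<Rightarrow>\<^sub>L 'a" assume l: "l \<in> Kset"
    have "essnorm (S + T) \<le> norm (S + T + (k + l))"
      by (intro essnorm_le subspace_add[OF subspace_Kset] k l)
    also have "\<dots> = norm ((S + k) + (T + l))" by (simp add: algebra_simps)
    also have "\<dots> \<le> norm (S + k) + norm (T + l)" by (rule norm_triangle_ineq)
    finally show "essnorm (S + T) - norm (S + k) \<le> norm (T + l)" by simp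
  qed
  then have "essnorm (S + T) - essnorm T \<le> essnorm S"
    by (intro le_essnormI) (simp add: algebra_simps)
  then show ?thesis by simp
qed

lemma essnorm_le_if_diff_Kset: "S - T \<in> Kset \<Longrightarrow> essnorm S \<le> essnorm T"
  using essnorm_add[of "S - T" T] by (simp add: essnorm_Kset)

lemma essnorm_cscaleL_le: "essnorm (cscaleL c T) \<le> cmod c * essnorm T"
proof (rule le_mult_essnormI)
  fix k :: "'a \<Rightarrow>\<^sub>L 'a" assume "k \<in> Kset"
  then have "essnorm (cscaleL c T) \<le> norm (cscaleL c T + cscaleL c k)"
    by (intro essnorm_le Kset_cscaleL)
  then show "essnorm (cscaleL c T) \<le> cmod c * norm (T + k)" by (simp flip: cscaleL_add_right)
qed simp

lemma essnorm_cscaleL: "essnorm (cscaleL c T) = cmod c * essnorm T"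
  by (rule cscaleL_homogeneous_if_le) (simp_all add: essnorm_cscaleL_le)

lemma essnorm_compose:
  assumes S: "S \<in> BH" and T: "T \<in> BH"
  shows "essnorm (S o\<^sub>L T) \<le> essnorm S * essnorm T"
proof -
  have "essnorm (S o\<^sub>L T) \<le> norm (S + k) * norm (T + l)" if k: "k \<in> Kset" and l: "l \<in> Kset" for k l
  proof -
    have "essnorm (S o\<^sub>L T) \<le> norm ((S o\<^sub>L T) + ((S o\<^sub>L l) + (k o\<^sub>L (T + l))))"
      by (intro essnorm_le subspace_add[OF subspace_Kset] Kset_compose_left Kset_compose_right
          BH.closed_intros S T k l Kset_BH)
    also have "(S o\<^sub>L T) + ((S o\<^sub>L l) + (k o\<^sub>L (T + l))) = (S + k) o\<^sub>L (T + l)"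
      by (simp add: compose_simps)
    finally show ?thesis using norm_blinfun_compose[of "S + k" "T + l"] by linarith
  qed
  then have "essnorm (S o\<^sub>L T) \<le> norm (S + k) * essnorm T" if "k \<in> Kset" for k
    using that by (intro le_mult_essnormI) auto
  then have "essnorm (S o\<^sub>L T) \<le> essnorm T * essnorm S"
    by (intro le_mult_essnormI) (auto simp: mult.commute)
  then show ?thesis by (simp add: mult.commute)
qed

text \<open>For a finite-rank projection \<open>P\<close> with \<open>P k \<approx> k\<close>, the compression of \<open>T T\<^sup>* + k\<close> to the range
  of \<open>1 - P\<close> is close to that of \<open>T T\<^sup>*\<close>.\<close>

lemma essnorm_power2_le:
  assumes T: "T \<in> BH"
  shows "(essnorm T)\<^sup>2 \<le> essnorm (T o\<^sub>L adjL T)"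
proof (rule le_essnormI, rule field_le_epsilon)
  fix k :: "'a \<Rightarrow>\<^sub>L 'a" and e :: real
  assume k: "k \<in> Kset" and e: "e > 0"
  obtain P where P: "P \<in> finite_rank" "orthogonal_projection P" "norm (k - (P o\<^sub>L k)) \<le> e"
    using Kset_finite_rank_approx[OF k e] .
  define Q where "Q = id_blinfun - P"
  have norm_Q: "norm Q \<le> 1" unfolding Q_def by (rule norm_id_minus_orthogonal_projection[OF P(2)])
  have adj_Q: "adjL Q = Q" using P(2) by (simp add: Q_def orthogonal_projection_def)
  have "essnorm T \<le> norm (T + - (P o\<^sub>L T))"
    by (intro essnorm_le subspace_neg[OF subspace_Kset] Kset_compose_right T finite_rank_Kset P)
  also have "T + - (P o\<^sub>L T) = Q o\<^sub>L T" by (simp add: Q_def compose_simps)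
  finally have "(essnorm T)\<^sup>2 \<le> norm ((Q o\<^sub>L T) o\<^sub>L adjL (Q o\<^sub>L T))"
    unfolding norm_compose_adjL by (simp add: power_mono)
  also have "(Q o\<^sub>L T) o\<^sub>L adjL (Q o\<^sub>L T) = ((Q o\<^sub>L ((T o\<^sub>L adjL T) + k)) o\<^sub>L Q) - ((Q o\<^sub>L k) o\<^sub>L Q)"
    by (simp add: adjL_compose adj_Q compose_simps)
  also have "norm \<dots> \<le> norm ((Q o\<^sub>L ((T o\<^sub>L adjL T) + k)) o\<^sub>L Q) + norm ((Q o\<^sub>L k) o\<^sub>L Q)"
    by (rule norm_triangle_ineq4)
  also have "\<dots> \<le> norm (Q o\<^sub>L ((T o\<^sub>L adjL T) + k)) + norm (Q o\<^sub>L k)"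
    by (intro add_mono norm_compose_contraction norm_Q)
  also have "\<dots> \<le> norm ((T o\<^sub>L adjL T) + k) + e"
    using P(3) by (intro add_mono norm_compose_contraction norm_Q) (simp add: Q_def compose_simps)
  finally show "(essnorm T)\<^sup>2 \<le> norm ((T o\<^sub>L adjL T) + k) + e" .
qed

lemma essnorm_adjL:
  assumes T: "T \<in> BH"
  shows "essnorm (adjL T) = essnorm T"
proof -
  have "essnorm S \<le> essnorm (adjL S)" if S: "S \<in> BH" for S :: "'a \<Rightarrow>\<^sub>L 'a"
    using order_trans[OF essnorm_power2_le[OF S] essnorm_compose[OF S adjL_BH[OF S]]]
    by (rule le_if_power2_le_mult) simp
  from this[OF T] this[OF adjL_BH[OF T]] show ?thesis by simp
qed

lemma essnorm_square:
  assumes T: "T \<in> BH" and normal: "(adjL T o\<^sub>L T) - (T o\<^sub>L adjL T) \<in> Kset"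
  shows "essnorm (T o\<^sub>L T) = (essnorm T)\<^sup>2"
proof (rule antisym)
  show "essnorm (T o\<^sub>L T) \<le> (essnorm T)\<^sup>2"
    using essnorm_compose[OF T T] by (simp add: power2_eq_square)
  let ?S = "T o\<^sub>L adjL T" and ?T2 = "T o\<^sub>L T"
  have BH: "adjL T \<in> BH" "?S \<in> BH" "?T2 \<in> BH" using T by (auto intro: adjL_BH BH.compose_closed)
  have "((essnorm T)\<^sup>2)\<^sup>2 \<le> (essnorm ?S)\<^sup>2" by (intro power_mono essnorm_power2_le T) auto
  also have "\<dots> \<le> essnorm (?S o\<^sub>L ?S)" using essnorm_power2_le[OF BH(2)] by (simp add: adjL_compose)
  also have "\<dots> \<le> essnorm (?T2 o\<^sub>L adjL ?T2)"
  proof (rule essnorm_le_if_diff_Kset)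
    have "(?S o\<^sub>L ?S) - (?T2 o\<^sub>L adjL ?T2) = T o\<^sub>L (((adjL T o\<^sub>L T) - (T o\<^sub>L adjL T)) o\<^sub>L adjL T)"
      by (simp add: adjL_compose compose_simps)
    also have "\<dots> \<in> Kset" by (intro Kset_compose_left Kset_compose_right normal T BH)
    finally show "(?S o\<^sub>L ?S) - (?T2 o\<^sub>L adjL ?T2) \<in> Kset" .
  qed
  also have "\<dots> \<le> essnorm ?T2 * essnorm (adjL ?T2)" by (intro essnorm_compose BH adjL_BH)
  also have "\<dots> = (essnorm ?T2)\<^sup>2" by (simp add: essnorm_adjL BH power2_eq_square)
  finally show "(essnorm T)\<^sup>2 \<le> essnorm ?T2" by (rule power2_le_imp_le) simp
qed

section \<open>States on C*-algebras\<close>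

instance chilbert \<subseteq> banach ..

lemma dist_half_square_le:
  fixes x y z :: "'a::real_normed_vector \<Rightarrow>\<^sub>L 'a"
  assumes bound: "norm y \<le> q" "norm z \<le> q"
  shows "dist ((1/2) *\<^sub>R (x + (y o\<^sub>L y))) ((1/2) *\<^sub>R (x + (z o\<^sub>L z))) \<le> q * dist y z"
proof -
  have "0 \<le> q" using bound(1) norm_ge_zero order_trans by blast
  have "norm ((y o\<^sub>L (y - z)) + ((y - z) o\<^sub>L z)) \<le> norm y * norm (y - z) + norm (y - z) * norm z"
    by (intro norm_triangle_mono norm_blinfun_compose)
  also have "\<dots> \<le> q * norm (y - z) + norm (y - z) * q"
    by (intro add_mono mult_mono bound) (use \<open>0 \<le> q\<close> in auto)
  finally have "norm ((1/2) *\<^sub>R ((y o\<^sub>L (y - z)) + ((y - z) o\<^sub>L z))) \<le> q * dist y z"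
    by (simp add: dist_norm)
  moreover have "(1/2) *\<^sub>R (x + (y o\<^sub>L y)) - (1/2) *\<^sub>R (x + (z o\<^sub>L z)) =
      (1/2) *\<^sub>R ((y o\<^sub>L (y - z)) + ((y - z) o\<^sub>L z))"
    by (simp add: compose_simps algebra_simps)
  ultimately show ?thesis by (simp only: dist_norm)
qed

locale cstar_algebra =
  fixes AA :: "('h::chilbert \<Rightarrow>\<^sub>L 'h) set"
  assumes cstar: "unital_cstar_subalg AA"

sublocale cstar_algebra \<subseteq> unital_operator_algebra AA
  using cstar
  by (intro unital_closed_subalg_imp_operator_algebra) (simp add: unital_cstar_subalg_def)

context cstar_algebra
begin

lemma adjL_closed: "a \<in> AA \<Longrightarrow> adjL a \<in> AA"
  using cstar by (simp add: unital_cstar_subalg_def)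

lemmas closed_intros = closed_intros adjL_closed

text \<open>Writing the square root of \<open>1 - x\<close> as \<open>1 - y\<close> turns its equation into \<open>y = (x + y\<^sup>2) / 2\<close>.\<close>

lemma selfadjoint_half_square_fixpoint:
  assumes x: "x \<in> AA" "adjL x = x" "norm x < 1"
  obtains y where "y \<in> AA" "adjL y = y" "y = (1/2) *\<^sub>R (x + (y o\<^sub>L y))"
proof -
  define q where "q = norm x"
  have q: "0 \<le> q" "q < 1" using x by (auto simp: q_def)
  define S where "S = AA \<inter> {y. adjL y = y} \<inter> cball 0 q"
  define f where "f y = (1/2) *\<^sub>R (x + (y o\<^sub>L y))" for y
  have "closed S"
    unfolding S_def using cstar linear_continuous_on[OF bounded_linear_adjL, of UNIV]
    by (intro closed_Int closed_cball closed_Collect_eq continuous_on_id)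
      (auto simp: unital_cstar_subalg_def unital_closed_subalg_def)
  then have "complete S" by (simp add: complete_eq_closed)
  moreover have "0 \<in> S" using q by (simp add: S_def closed_intros)
  then have "S \<noteq> {}" by blast
  moreover have "f ` S \<subseteq> S"
  proof safe
    fix y assume y: "y \<in> S"
    have "norm (y o\<^sub>L y) \<le> norm y" using y q by (intro norm_compose_contraction) (auto simp: S_def)
    then have "norm (x + (y o\<^sub>L y)) \<le> q + q"
      using y norm_triangle_ineq[of x "y o\<^sub>L y"] by (auto simp: S_def q_def)
    then have "norm (f y) \<le> q" by (simp add: f_def)
    then show "f y \<in> S" using y x by (auto simp: S_def f_def adjL_compose intro!: closed_intros)
  qed
  moreover have "dist (f y) (f z) \<le> q * dist y z" if "y \<in> S" "z \<in> S" for y z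
    unfolding f_def by (rule dist_half_square_le) (use that in \<open>auto simp: S_def\<close>)
  ultimately obtain y where "y \<in> S" "f y = y" using Banach_fix[of S q f] q by blast
  then show thesis by (intro that[of y]) (auto simp: S_def f_def)
qed

lemma selfadjoint_sqrt_id_minus:
  assumes x: "x \<in> AA" "adjL x = x" "norm x < 1"
  obtains r where "r \<in> AA" "adjL r = r" "r o\<^sub>L r = id_blinfun - x"
proof -
  obtain y where y: "y \<in> AA" "adjL y = y" "y = (1/2) *\<^sub>R (x + (y o\<^sub>L y))"
    using selfadjoint_half_square_fixpoint[OF x] .
  have "2 *\<^sub>R y = x + (y o\<^sub>L y)" by (subst y(3)) simp
  then have "y o\<^sub>L y = y + y - x" by (simp add: scaleR_2 algebra_simps)
  then have "(id_blinfun - y) o\<^sub>L (id_blinfun - y) = id_blinfun - x" by (simp add: compose_simps)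
  with y(1,2) show thesis by (intro that[of "id_blinfun - y"]) (auto intro: closed_intros)
qed

lemma adjL_compose_add_scalar:
  assumes "a \<in> AA"
  shows "adjL (a + scalar c) o\<^sub>L (a + scalar c) =
    (adjL a o\<^sub>L a) + (cscaleL c (adjL a) + (cscaleL (cnj c) a + scalar (c * cnj c)))"
  using in_BH[OF assms]
  by (simp add: adjL_cscaleL BH.closed_intros adjL_BH BH_compose_cscaleL cscaleL_simps
      compose_simps mult.commute)

end

definition gns_sq :: "(('a::chilbert \<Rightarrow>\<^sub>L 'a) \<Rightarrow> complex) \<Rightarrow> ('a \<Rightarrow>\<^sub>L 'a) \<Rightarrow> real" where
  "gns_sq \<psi> a = Re (\<psi> (adjL a o\<^sub>L a))"

definition compression ::
  "(('a::chilbert \<Rightarrow>\<^sub>L 'a) \<Rightarrow> complex) \<Rightarrow> ('a \<Rightarrow>\<^sub>L 'a) \<Rightarrow> ('a \<Rightarrow>\<^sub>L 'a) \<Rightarrow> complex" where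
  "compression \<psi> p a = \<psi> (adjL p o\<^sub>L a o\<^sub>L p) / of_real (gns_sq \<psi> p)"

lemma gns_sq_compression: "gns_sq (compression \<psi> p) a = gns_sq \<psi> (a o\<^sub>L p) / gns_sq \<psi> p"
  by (simp add: gns_sq_def compression_def conjugate_adjL_compose)

locale cstar_state = cstar_algebra AA for AA :: "('h::chilbert \<Rightarrow>\<^sub>L 'h) set" +
  fixes \<psi> :: "('h \<Rightarrow>\<^sub>L 'h) \<Rightarrow> complex"
  assumes state: "state AA \<psi>"
begin

lemma state_add: "a \<in> AA \<Longrightarrow> b \<in> AA \<Longrightarrow> \<psi> (a + b) = \<psi> a + \<psi> b"
  and state_cscaleL: "a \<in> AA \<Longrightarrow> \<psi> (cscaleL c a) = c * \<psi> a"
  and state_id: "\<psi> id_blinfun = 1"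
  using state by (auto simp: state_def clinear_on_def)

lemma gns_sq_nonneg: "a \<in> AA \<Longrightarrow> 0 \<le> gns_sq \<psi> a"
  and state_adjL_compose: "a \<in> AA \<Longrightarrow> \<psi> (adjL a o\<^sub>L a) = of_real (gns_sq \<psi> a)"
  using state by (auto simp: state_def gns_sq_def complex_eq_iff)

lemma state_scaleR: "a \<in> AA \<Longrightarrow> \<psi> (r *\<^sub>R a) = of_real r * \<psi> a"
  using state_cscaleL[of a "of_real r"] by (simp add: cscaleL_simps)

lemma state_zero: "\<psi> 0 = 0"
  using state_scaleR[OF id_closed, of 0] by simp

lemma state_diff: "a \<in> AA \<Longrightarrow> b \<in> AA \<Longrightarrow> \<psi> (a - b) = \<psi> a - \<psi> b"
  using state_add[of a "- b"] state_scaleR[of b "-1"] by (simp add: closed_intros)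

lemmas state_simps = state_add state_diff state_scaleR state_cscaleL state_id state_zero

lemma state_adjL:
  assumes a: "a \<in> AA"
  shows "\<psi> (adjL a) = cnj (\<psi> a)"
proof -
  have Im: "Im (c * \<psi> (adjL a) + cnj c * \<psi> a) = 0" for c
  proof -
    let ?b = "a + scalar c"
    have "\<psi> (adjL ?b o\<^sub>L ?b) = \<psi> (adjL a o\<^sub>L a) + ((c * \<psi> (adjL a) + cnj c * \<psi> a) + c * cnj c)"
      unfolding adjL_compose_add_scalar[OF a] by (simp add: state_simps closed_intros a)
    moreover have "\<psi> (adjL ?b o\<^sub>L ?b) = of_real (gns_sq \<psi> ?b)"
      by (intro state_adjL_compose closed_intros a)
    ultimately have "Im (of_real (gns_sq \<psi> ?b)) =
        Im (of_real (gns_sq \<psi> a) + ((c * \<psi> (adjL a) + cnj c * \<psi> a) + c * cnj c))"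
      unfolding state_adjL_compose[OF a] by metis
    then show ?thesis by simp
  qed
  from Im[of 1] Im[of \<i>] show ?thesis by (simp add: complex_eq_iff)
qed

lemma state_selfadjoint_le_norm:
  assumes x: "x \<in> AA" "adjL x = x"
  shows "Re (\<psi> x) \<le> norm x"
proof (rule dense_ge)
  fix r assume r: "norm x < r"
  then have "r > 0" using norm_ge_zero[of x] by linarith
  then have "norm ((1/r) *\<^sub>R x) < 1" using r by simp
  then obtain p where p: "p \<in> AA" "adjL p = p" "p o\<^sub>L p = id_blinfun - (1/r) *\<^sub>R x"
    using selfadjoint_sqrt_id_minus[of "(1/r) *\<^sub>R x"] x by (auto simp: closed_intros)
  have "gns_sq \<psi> p = 1 - Re (\<psi> x) / r" using p x by (simp add: gns_sq_def state_simps closed_intros)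
  then have "Re (\<psi> x) / r \<le> 1" using gns_sq_nonneg[OF p(1)] by simp
  then show "Re (\<psi> x) \<le> r" using \<open>r > 0\<close> by (simp add: field_simps)
qed

lemma state_le_norm:
  assumes a: "a \<in> AA"
  shows "cmod (\<psi> a) \<le> norm a"
proof -
  obtain c where c: "cmod c = 1" "c * \<psi> a = of_real (cmod (\<psi> a))" by (rule complex_rotate_to_norm)
  define h where "h = (1/2) *\<^sub>R (cscaleL c a + adjL (cscaleL c a))"
  have h: "h \<in> AA" "adjL h = h"
    unfolding h_def using a by (auto simp: add.commute intro!: closed_intros)
  have "\<psi> h = of_real (cmod (\<psi> a))"
    using a c by (simp add: h_def state_simps closed_intros state_adjL del: complex_cnj_mult)
  then have "cmod (\<psi> a) \<le> norm h" using state_selfadjoint_le_norm[OF h] by simp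
  also have "\<dots> \<le> norm a"
    using norm_triangle_ineq[of "cscaleL c a" "adjL (cscaleL c a)"] c by (simp add: h_def)
  finally show ?thesis .
qed

lemma gns_sq_cscaleL:
  assumes "a \<in> AA"
  shows "gns_sq \<psi> (cscaleL c a) = (cmod c)\<^sup>2 * gns_sq \<psi> a"
proof -
  have "adjL (cscaleL c a) o\<^sub>L cscaleL c a = cscaleL (of_real ((cmod c)\<^sup>2)) (adjL a o\<^sub>L a)"
    using in_BH[OF assms]
    by (simp add: adjL_cscaleL cscaleL_simps BH_compose_cscaleL adjL_BH complex_norm_square
        mult.commute del: of_real_power)
  then show ?thesis using assms by (simp add: gns_sq_def state_simps closed_intros)
qed

lemma state_Cauchy_Schwarz_Re:
  assumes a: "a \<in> AA" and b: "b \<in> AA"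
  shows "(Re (\<psi> (adjL b o\<^sub>L a)))\<^sup>2 \<le> gns_sq \<psi> b * gns_sq \<psi> a"
proof (rule quadratic_nonneg_imp_discriminant_le)
  fix s :: real
  let ?z = "b + s *\<^sub>R a"
  have "adjL ?z o\<^sub>L ?z = (adjL b o\<^sub>L b) +
      (s *\<^sub>R ((adjL b o\<^sub>L a) + adjL (adjL b o\<^sub>L a)) + (s * s) *\<^sub>R (adjL a o\<^sub>L a))"
    by (simp add: adjL_compose compose_simps algebra_simps)
  then have "gns_sq \<psi> ?z = gns_sq \<psi> b + 2 * s * Re (\<psi> (adjL b o\<^sub>L a)) + s\<^sup>2 * gns_sq \<psi> a"
    by (simp add: gns_sq_def state_simps state_adjL closed_intros a b power2_eq_square)
  then show "0 \<le> gns_sq \<psi> b + 2 * s * Re (\<psi> (adjL b o\<^sub>L a)) + s\<^sup>2 * gns_sq \<psi> a"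
    using gns_sq_nonneg[of ?z] by (simp add: closed_intros a b)
qed (rule gns_sq_nonneg[OF a])

lemma state_Cauchy_Schwarz:
  assumes a: "a \<in> AA" and b: "b \<in> AA"
  shows "(cmod (\<psi> (adjL b o\<^sub>L a)))\<^sup>2 \<le> gns_sq \<psi> b * gns_sq \<psi> a"
proof -
  obtain c where c: "cmod c = 1" "c * \<psi> (adjL b o\<^sub>L a) = of_real (cmod (\<psi> (adjL b o\<^sub>L a)))"
    by (rule complex_rotate_to_norm)
  have "adjL b o\<^sub>L cscaleL c a = cscaleL c (adjL b o\<^sub>L a)"
    by (intro BH_compose_cscaleL in_BH closed_intros b)
  then have "\<psi> (adjL b o\<^sub>L cscaleL c a) = of_real (cmod (\<psi> (adjL b o\<^sub>L a)))"
    using a b c by (simp add: state_simps closed_intros)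
  then show ?thesis
    using state_Cauchy_Schwarz_Re[OF cscaleL_closed[OF a, of c] b] c(1)
    by (simp add: gns_sq_cscaleL a)
qed

lemma state_compose_eq_0:
  assumes "a \<in> AA" "b \<in> AA" "gns_sq \<psi> b = 0"
  shows "\<psi> (adjL b o\<^sub>L a) = 0"
  using state_Cauchy_Schwarz[OF assms(1,2)] assms(3) by simp

lemma compression_adjL_compose:
  assumes "a \<in> AA" "p \<in> AA"
  shows "compression \<psi> p (adjL a o\<^sub>L a) = of_real (gns_sq \<psi> (a o\<^sub>L p) / gns_sq \<psi> p)"
  using assms by (simp add: compression_def conjugate_adjL_compose state_adjL_compose closed_intros)

lemma state_compression:
  assumes p: "p \<in> AA" "gns_sq \<psi> p \<noteq> 0"
  shows "state AA (compression \<psi> p)"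
  unfolding state_def clinear_on_def
proof (intro conjI ballI allI)
  fix a b and c :: complex assume a: "a \<in> AA"
  show "compression \<psi> p (a + b) = compression \<psi> p a + compression \<psi> p b" if "b \<in> AA"
    using p a that
    by (simp add: compression_def compose_simps state_simps closed_intros add_divide_distrib)
  show "compression \<psi> p (cscaleL c a) = c * compression \<psi> p a"
    using p a
    by (simp add: compression_def BH_compose_cscaleL in_BH cscaleL_simps state_simps closed_intros)
  show "Im (compression \<psi> p (adjL a o\<^sub>L a)) = 0" "0 \<le> Re (compression \<psi> p (adjL a o\<^sub>L a))"
    unfolding compression_adjL_compose[OF a p(1)] Im_complex_of_real Re_complex_of_real
    by (intro refl divide_nonneg_nonneg gns_sq_nonneg closed_intros a p)+
next
  show "compression \<psi> p id_blinfun = 1"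
    using p by (simp add: compression_def state_adjL_compose)
qed

lemma gns_sq_compose_le:
  assumes a: "a \<in> AA" and b: "b \<in> AA"
  shows "gns_sq \<psi> (a o\<^sub>L b) \<le> (norm a)\<^sup>2 * gns_sq \<psi> b"
proof (cases "gns_sq \<psi> b = 0")
  case True
  have "adjL (a o\<^sub>L b) o\<^sub>L (a o\<^sub>L b) = adjL b o\<^sub>L (adjL a o\<^sub>L (a o\<^sub>L b))"
    by (simp add: adjL_compose blinfun_compose_assoc)
  then have "gns_sq \<psi> (a o\<^sub>L b) = Re (\<psi> (adjL b o\<^sub>L (adjL a o\<^sub>L (a o\<^sub>L b))))"
    by (simp add: gns_sq_def)
  also have "\<dots> = 0" using state_compose_eq_0[OF _ b True] a b by (simp add: closed_intros)
  finally show ?thesis using True by simp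
next
  case False
  then have pos: "gns_sq \<psi> b > 0" using gns_sq_nonneg[OF b] by simp
  interpret \<phi>: cstar_state AA "compression \<psi> b"
    by unfold_locales (rule state_compression[OF b False])
  have "Re (compression \<psi> b (adjL a o\<^sub>L a)) \<le> norm (adjL a o\<^sub>L a)"
    using complex_Re_le_cmod \<phi>.state_le_norm by (rule order_trans) (intro closed_intros a)
  then have "gns_sq \<psi> (a o\<^sub>L b) / gns_sq \<psi> b \<le> (norm a)\<^sup>2"
    unfolding compression_adjL_compose[OF a b] norm_adjL_compose by simp
  then show ?thesis using pos by (simp add: field_simps)
qed

lemma state_vanishes_on_Kset:
  assumes sub: "Kset \<subseteq> AA" and rank1: "\<And>v e. \<psi> (rank1 v e) = 0" and k: "k \<in> Kset"
  shows "\<psi> k = 0"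
proof -
  have "subspace {T \<in> AA. \<psi> T = 0}"
    using subspace by (auto simp: subspace_def state_simps)
  then have "finite_rank \<subseteq> {T \<in> AA. \<psi> T = 0}"
    by (rule finite_rank_subset) (use sub rank1_Kset rank1 in auto)
  then have fin: "\<psi> T = 0" if "T \<in> finite_rank" for T using that by blast
  have "cmod (\<psi> k) \<le> 0 + e" if e: "e > 0" for e
  proof -
    obtain P where P: "P \<in> finite_rank" "norm (k - (P o\<^sub>L k)) \<le> e"
      using Kset_finite_rank_approx[OF k e] by blast
    have Pk: "P o\<^sub>L k \<in> finite_rank" by (rule finite_rank_compose[OF P(1) Kset_BH[OF k]])
    have AA: "k \<in> AA" "P o\<^sub>L k \<in> AA" using sub k finite_rank_Kset[OF Pk] by auto
    then have "\<psi> k = \<psi> (k - (P o\<^sub>L k))" using fin[OF Pk] by (simp add: state_diff)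
    also have "cmod \<dots> \<le> norm (k - (P o\<^sub>L k))" by (intro state_le_norm closed_intros AA)
    finally show ?thesis using P by simp
  qed
  then have "cmod (\<psi> k) \<le> 0" by (rule field_le_epsilon)
  then show ?thesis by simp
qed

lemma state_le_essnorm:
  assumes "Kset \<subseteq> AA" "\<And>k. k \<in> Kset \<Longrightarrow> \<psi> k = 0" "a \<in> AA"
  shows "cmod (\<psi> a) \<le> essnorm a"
proof (rule le_essnormI)
  fix k :: "'h \<Rightarrow>\<^sub>L 'h" assume k: "k \<in> Kset"
  then have "\<psi> (a + k) = \<psi> a" using assms by (subst state_add) auto
  then show "cmod (\<psi> a) \<le> norm (a + k)"
    using state_le_norm[of "a + k"] assms k by (auto simp: closed_intros)
qed

lemma state_convex_remainder:
  assumes \<phi>: "state AA \<phi>" and l: "0 < l" "l < 1" and le: "\<And>a. a \<in> AA \<Longrightarrow> l * gns_sq \<phi> a \<le> gns_sq \<psi> a"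
  shows "state AA (\<lambda>a. (\<psi> a - of_real l * \<phi> a) / of_real (1 - l))"
  unfolding state_def clinear_on_def
proof (intro conjI ballI allI)
  interpret \<phi>: cstar_state AA \<phi> by unfold_locales (rule \<phi>)
  let ?\<rho> = "\<lambda>a. (\<psi> a - of_real l * \<phi> a) / of_real (1 - l)"
  fix a b and c :: complex assume a: "a \<in> AA"
  show "?\<rho> (a + b) = ?\<rho> a + ?\<rho> b" if "b \<in> AA"
    using a that
    by (simp add: state_add \<phi>.state_add add_divide_distrib diff_divide_distrib distrib_left)
  show "?\<rho> (cscaleL c a) = c * ?\<rho> a"
    using a by (simp add: state_cscaleL \<phi>.state_cscaleL algebra_simps diff_divide_distrib)
  have "?\<rho> (adjL a o\<^sub>L a) = of_real ((gns_sq \<psi> a - l * gns_sq \<phi> a) / (1 - l))"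
    using a by (simp add: state_adjL_compose \<phi>.state_adjL_compose)
  then show "Im (?\<rho> (adjL a o\<^sub>L a)) = 0" "0 \<le> Re (?\<rho> (adjL a o\<^sub>L a))"
    using le[OF a] l by (simp_all only: Im_complex_of_real Re_complex_of_real) simp
next
  have "complex_of_real (1 - l) \<noteq> 0" using l by (simp only: of_real_eq_0_iff)
  then show "(\<psi> id_blinfun - of_real l * \<phi> id_blinfun) / of_real (1 - l) = 1"
    using \<phi> by (simp add: state_id state_def)
qed

end

section \<open>Pure states\<close>

locale cstar_pure_state = cstar_algebra AA for AA :: "('h::chilbert \<Rightarrow>\<^sub>L 'h) set" +
  fixes \<psi> :: "('h \<Rightarrow>\<^sub>L 'h) \<Rightarrow> complex"
  assumes pure: "pure_state AA \<psi>"

sublocale cstar_pure_state \<subseteq> cstar_state AA \<psi>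
  using pure by unfold_locales (simp add: pure_state_def)

context cstar_pure_state
begin

lemma eq_dominated_state:
  assumes \<phi>: "state AA \<phi>" and C: "C > 0"
    and dom: "\<And>a. a \<in> AA \<Longrightarrow> gns_sq \<phi> a \<le> C * gns_sq \<psi> a" and a: "a \<in> AA"
  shows "\<phi> a = \<psi> a"
proof -
  define l where "l = min (1/2) (1/C)"
  have l: "0 < l" "l < 1" "l * C \<le> 1" using C by (auto simp: l_def field_simps min_def)
  define \<rho> where "\<rho> a = (\<psi> a - of_real l * \<phi> a) / of_real (1 - l)" for a
  have "state AA \<rho>" unfolding \<rho>_def
  proof (rule state_convex_remainder[OF \<phi> l(1,2)])
    fix b assume b: "b \<in> AA"
    have "l * gns_sq \<phi> b \<le> (l * C) * gns_sq \<psi> b" using dom[OF b] l(1) by (simp add: mult.assoc)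
    also have "\<dots> \<le> 1 * gns_sq \<psi> b" by (intro mult_right_mono l gns_sq_nonneg b)
    finally show "l * gns_sq \<phi> b \<le> gns_sq \<psi> b" by simp
  qed
  moreover have "\<forall>a\<in>AA. \<psi> a = of_real l * \<phi> a + of_real (1 - l) * \<rho> a"
  proof -
    have "complex_of_real (1 - l) \<noteq> 0" using l by (simp only: of_real_eq_0_iff)
    then show ?thesis by (simp add: \<rho>_def)
  qed
  ultimately show ?thesis using pure \<phi> l a unfolding pure_state_def by blast
qed

context
  assumes trace: "\<And>a b. a \<in> AA \<Longrightarrow> b \<in> AA \<Longrightarrow> \<psi> (a o\<^sub>L b) = \<psi> (b o\<^sub>L a)"
begin

lemma trace_gns_sq_adjL: "a \<in> AA \<Longrightarrow> gns_sq \<psi> (adjL a) = gns_sq \<psi> a"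
  using trace[of a "adjL a"] by (simp add: gns_sq_def closed_intros)

lemma trace_gns_sq_compose_le:
  assumes a: "a \<in> AA" and b: "b \<in> AA"
  shows "gns_sq \<psi> (a o\<^sub>L b) \<le> (norm b)\<^sup>2 * gns_sq \<psi> a"
proof -
  have "gns_sq \<psi> (a o\<^sub>L b) = gns_sq \<psi> (adjL b o\<^sub>L adjL a)"
    using trace_gns_sq_adjL[OF compose_closed[OF a b]] by (simp add: adjL_compose)
  also have "\<dots> \<le> (norm (adjL b))\<^sup>2 * gns_sq \<psi> (adjL a)"
    by (intro gns_sq_compose_le closed_intros a b)
  finally show ?thesis by (simp add: trace_gns_sq_adjL a)
qed

text \<open>By the preceding bound \<open>\<psi>\<close> dominates its compression by \<open>p\<^sup>*\<close>, so purity forces the two states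
  to be equal; polarisation then gives all products.\<close>

lemma trace_compose_adjL_compose:
  assumes a: "a \<in> AA" and p: "p \<in> AA"
  shows "\<psi> (a o\<^sub>L (adjL p o\<^sub>L p)) = \<psi> a * \<psi> (adjL p o\<^sub>L p)"
proof -
  let ?q = "adjL p" and ?g = "gns_sq \<psi> (adjL p)"
  have q: "?q \<in> AA" by (rule adjL_closed[OF p])
  have cyclic: "\<psi> (a o\<^sub>L (?q o\<^sub>L p)) = \<psi> (p o\<^sub>L a o\<^sub>L ?q)"
    using trace[of "a o\<^sub>L ?q" p] a p q by (simp add: blinfun_compose_assoc closed_intros)
  have square: "\<psi> (adjL p o\<^sub>L p) = of_real ?g" by (simp add: state_adjL_compose trace_gns_sq_adjL p)
  show ?thesis
  proof (cases "?g = 0")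
    case True
    then show ?thesis
      using state_compose_eq_0[of "a o\<^sub>L ?q" ?q] a q cyclic square
      by (simp add: blinfun_compose_assoc closed_intros)
  next
    case False
    then have g: "?g > 0" using gns_sq_nonneg[OF q] by simp
    have "compression \<psi> ?q a = \<psi> a"
    proof (rule eq_dominated_state[OF state_compression[OF q False] _ _ a])
      have "0 < (norm ?q)\<^sup>2 * gns_sq \<psi> id_blinfun" using g gns_sq_compose_le[OF q id_closed] by simp
      then have "norm p \<noteq> 0" by auto
      then show "(norm p)\<^sup>2 / ?g > 0" using g by simp
      show "gns_sq (compression \<psi> ?q) b \<le> (norm p)\<^sup>2 / ?g * gns_sq \<psi> b" if b: "b \<in> AA" for b
        using divide_right_mono[OF trace_gns_sq_compose_le[OF b q], of ?g] g
        by (simp add: gns_sq_compression)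
    qed
    then show ?thesis using False by (simp add: compression_def cyclic square field_simps)
  qed
qed

lemma trace_multiplicative:
  assumes a: "a \<in> AA" and b: "b \<in> AA"
  shows "\<psi> (a o\<^sub>L b) = \<psi> a * \<psi> b"
proof -
  have polar: "c * \<psi> (a o\<^sub>L adjL b) + cnj c * \<psi> (a o\<^sub>L b) =
      \<psi> a * (c * \<psi> (adjL b) + cnj c * \<psi> b)" for c
  proof -
    let ?p = "b + scalar c"
    have "\<psi> (a o\<^sub>L (adjL ?p o\<^sub>L ?p)) = \<psi> a * \<psi> (adjL ?p o\<^sub>L ?p)"
      by (intro trace_compose_adjL_compose a b closed_intros)
    moreover have "\<psi> (a o\<^sub>L (adjL b o\<^sub>L b)) = \<psi> a * \<psi> (adjL b o\<^sub>L b)"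
      by (rule trace_compose_adjL_compose[OF a b])
    ultimately show ?thesis unfolding adjL_compose_add_scalar[OF b]
      using a b in_BH[OF a]
      by (simp add: compose_simps BH_compose_cscaleL state_simps closed_intros algebra_simps)
  qed
  have plus: "\<psi> (a o\<^sub>L adjL b) + \<psi> (a o\<^sub>L b) = \<psi> a * (\<psi> (adjL b) + \<psi> b)"
    using polar[of 1] by simp
  have "\<i> * (\<psi> (a o\<^sub>L adjL b) - \<psi> (a o\<^sub>L b)) = \<i> * (\<psi> a * (\<psi> (adjL b) - \<psi> b))"
    using polar[of \<i>] by (simp add: algebra_simps)
  then have minus: "\<psi> (a o\<^sub>L adjL b) - \<psi> (a o\<^sub>L b) = \<psi> a * (\<psi> (adjL b) - \<psi> b)" by simp
  have "2 * \<psi> (a o\<^sub>L b) = (\<psi> (a o\<^sub>L adjL b) + \<psi> (a o\<^sub>L b)) - (\<psi> (a o\<^sub>L adjL b) - \<psi> (a o\<^sub>L b))"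
    by simp
  also have "\<dots> = 2 * (\<psi> a * \<psi> b)" unfolding plus minus by (simp add: algebra_simps)
  finally show ?thesis by simp
qed

end

end

definition vector_state :: "'h::chilbert \<Rightarrow> ('h \<Rightarrow>\<^sub>L 'h) \<Rightarrow> complex" where
  "vector_state u a = cinner (blinfun_apply a u) u"

lemma vector_state_adjL_compose:
  assumes "a \<in> BH"
  shows "vector_state u (adjL a o\<^sub>L a) = of_real ((norm (blinfun_apply a u))\<^sup>2)"
  using cinner_adjL[OF adjL_BH[OF assms], of "a u" u] by (simp add: vector_state_def cinner_self)

lemma gns_sq_vector_state: "a \<in> BH \<Longrightarrow> gns_sq (vector_state u) a = (norm (blinfun_apply a u))\<^sup>2"
  by (simp add: gns_sq_def vector_state_adjL_compose)

lemma state_vector_state: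
  assumes "A \<subseteq> BH" "norm u = 1"
  shows "state A (vector_state u)"
proof -
  have "vector_state u id_blinfun = 1" using assms(2) by (simp add: vector_state_def cinner_self)
  moreover have "clinear_on A (vector_state u)"
    by (simp add: clinear_on_def vector_state_def blinfun.bilinear_simps cinner_simps)
  ultimately show ?thesis
    using assms(1)
    by (auto simp: state_def vector_state_adjL_compose subset_iff simp del: of_real_power)
qed

context cstar_pure_state
begin

lemma rank1_functional_represented:
  assumes "Kset \<subseteq> AA"
  obtains \<xi> where "\<And>v. \<psi> (rank1 v e) = cinner v \<xi>"
proof -
  have AA: "rank1 v e \<in> AA" for v using assms rank1_Kset by blast
  have "\<psi> (rank1 (v + w) e) = \<psi> (rank1 v e) + \<psi> (rank1 w e)" for v w
    by (simp add: rank1_add state_add AA)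
  moreover have "\<psi> (rank1 (c *\<^sub>C v) e) = c * \<psi> (rank1 v e)" for c v
    by (simp add: rank1_cscale state_cscaleL AA)
  moreover have "cmod (\<psi> (rank1 v e)) \<le> norm v * norm e" for v
    using state_le_norm[OF AA, of v] norm_rank1_le[of v e] by linarith
  ultimately obtain \<xi> where "\<And>v. \<psi> (rank1 v e) = cinner v \<xi>"
    using riesz_representation[of "\<lambda>v. \<psi> (rank1 v e)" "norm e"] by blast
  then show thesis by (rule that)
qed

text \<open>Cauchy-Schwarz for \<open>\<psi> (a\<^sup>* (w \<otimes> e\<^sup>*)) = \<langle>a\<^sup>* w, \<xi>\<rangle>\<close> at \<open>w = a \<xi>\<close>.\<close>

lemma represented_vector_functional_dominated:
  assumes sub: "Kset \<subseteq> AA" and \<xi>: "\<And>v. \<psi> (rank1 v e) = cinner v \<xi>" and a: "a \<in> AA"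
  shows "(norm (blinfun_apply a \<xi>))\<^sup>2 \<le> Re (\<psi> (rank1 e e)) * gns_sq \<psi> a"
proof (rule le_if_power2_le_mult)
  have AA: "rank1 v w \<in> AA" for v w using sub rank1_Kset by blast
  let ?w = "a \<xi>" and ?C = "Re (\<psi> (rank1 e e))"
  have gns: "gns_sq \<psi> (rank1 v e) = (norm v)\<^sup>2 * ?C" for v
  proof -
    have "adjL (rank1 v e) o\<^sub>L rank1 v e = cscaleL (of_real ((norm v)\<^sup>2)) (rank1 e e)"
      by (simp add: compose_rank1 rank1_BH cinner_self rank1_cscale del: of_real_power)
    then show ?thesis by (simp add: gns_sq_def state_simps AA)
  qed
  have "adjL a o\<^sub>L rank1 ?w e = rank1 (adjL a ?w) e" by (intro compose_rank1 adjL_BH in_BH a)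
  then have "\<psi> (adjL a o\<^sub>L rank1 ?w e) = of_real ((norm ?w)\<^sup>2)"
    using cinner_adjL[of "adjL a" ?w \<xi>] by (simp add: \<xi> in_BH adjL_closed a cinner_self)
  then show "((norm ?w)\<^sup>2)\<^sup>2 \<le> (norm ?w)\<^sup>2 * (?C * gns_sq \<psi> a)"
    using state_Cauchy_Schwarz[OF AA a, of ?w e] by (simp add: gns norm_power mult_ac)
  have "0 \<le> ?C"
    using gns[of e] gns_sq_nonneg[OF AA, of e e]
    by (cases "e = 0") (auto simp: zero_le_mult_iff state_zero)
  then show "0 \<le> ?C * gns_sq \<psi> a" using gns_sq_nonneg[OF a] by simp
qed

lemma eq_vector_state:
  assumes sub: "Kset \<subseteq> AA" and nonzero: "\<psi> (rank1 v e) \<noteq> 0"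
  obtains u where "norm u = 1" "\<And>a. a \<in> AA \<Longrightarrow> \<psi> a = vector_state u a"
proof -
  obtain \<xi> where \<xi>: "\<And>v. \<psi> (rank1 v e) = cinner v \<xi>"
    using rank1_functional_represented[OF sub] by metis
  define C where "C = Re (\<psi> (rank1 e e))"
  have dom: "(norm (a \<xi>))\<^sup>2 \<le> C * gns_sq \<psi> a" if "a \<in> AA" for a
    unfolding C_def by (rule represented_vector_functional_dominated[OF sub \<xi> that])
  have "\<xi> \<noteq> 0" using nonzero \<xi>[of v] by auto
  then have "0 < (norm \<xi>)\<^sup>2" by simp
  also have "\<dots> \<le> C" using dom[OF id_closed] by (simp add: gns_sq_def state_id)
  finally have C: "C > 0" .
  define u where "u = (1 / norm \<xi>) *\<^sub>R \<xi>"
  have u: "norm u = 1" using \<open>\<xi> \<noteq> 0\<close> by (simp add: u_def)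
  have "vector_state u a = \<psi> a" if a: "a \<in> AA" for a
  proof (rule eq_dominated_state[OF state_vector_state[OF subset_BH u] _ _ a])
    show "0 < C / (norm \<xi>)\<^sup>2" using C \<open>\<xi> \<noteq> 0\<close> by simp
    fix b assume b: "b \<in> AA"
    have "(norm (b u))\<^sup>2 = (norm (b \<xi>))\<^sup>2 / (norm \<xi>)\<^sup>2"
      by (simp add: u_def blinfun.bilinear_simps power_divide)
    then show "gns_sq (vector_state u) b \<le> C / (norm \<xi>)\<^sup>2 * gns_sq \<psi> b"
      using divide_right_mono[OF dom[OF b], of "(norm \<xi>)\<^sup>2"]
      by (simp add: gns_sq_vector_state in_BH b)
  qed
  then show thesis using u that by metis
qed

end

lemma characteristic_sequence_vector_state:
  assumes A: "A \<subseteq> BH" "rank1 u u \<in> A" and u: "norm u = 1"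
    and \<psi>: "\<And>a. a \<in> A \<Longrightarrow> \<psi> a = vector_state u a"
  shows "characteristic_sequence A \<psi> (\<lambda>n. rank1 u u)"
proof -
  let ?P = "rank1 u u"
  have Pu: "?P u = u" using u by (simp add: cinner_self cscale_simps)
  have "norm (?P u) \<le> norm ?P * norm u" by (rule norm_blinfun)
  then have "norm ?P = 1" using norm_rank1_le[of u u] unfolding Pu by (simp add: u)
  moreover have "\<psi> ?P = 1"
    unfolding \<psi>[OF A(2)] vector_state_def Pu using u by (simp add: cinner_self)
  moreover have "adjL ?P o\<^sub>L a o\<^sub>L ?P = cscaleL (\<psi> a) ?P" if "a \<in> A" for a
    using that A(1)
    by (auto simp: compose_simps compose_rank1 rank1_BH rank1_cscale \<psi> vector_state_def)
  ultimately show ?thesis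
    unfolding characteristic_sequence_def using A(2) by (simp add: Limsup_const)
qed

lemma (in cstar_pure_state) exists_rank1_characteristic_sequence:
  assumes "Kset \<subseteq> AA" "\<psi> (rank1 v e) \<noteq> 0"
  obtains u where "characteristic_sequence AA \<psi> (\<lambda>n. rank1 u u)"
proof -
  obtain u where "norm u = 1" "\<And>a. a \<in> AA \<Longrightarrow> \<psi> a = vector_state u a"
    using eq_vector_state[OF assms] by blast
  then have "characteristic_sequence AA \<psi> (\<lambda>n. rank1 u u)"
    using assms(1) rank1_Kset by (intro characteristic_sequence_vector_state subset_BH) auto
  then show thesis by (rule that)
qed

section \<open>Uniform seminorms\<close>

locale uniform_seminorm = unital_operator_algebra AA for AA :: "('h::chilbert \<Rightarrow>\<^sub>L 'h) set" +
  fixes p :: "('h \<Rightarrow>\<^sub>L 'h) \<Rightarrow> real"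
  assumes nonneg [simp]: "0 \<le> p x"
    and add_le: "x \<in> AA \<Longrightarrow> y \<in> AA \<Longrightarrow> p (x + y) \<le> p x + p y"
    and cscaleL: "x \<in> AA \<Longrightarrow> p (cscaleL c x) = cmod c * p x"
    and compose_le: "x \<in> AA \<Longrightarrow> y \<in> AA \<Longrightarrow> p (x o\<^sub>L y) \<le> p x * p y"
    and square: "x \<in> AA \<Longrightarrow> p (x o\<^sub>L x) = (p x)\<^sup>2"
    and id_eq_1: "p id_blinfun = 1"
    and commutator: "x \<in> AA \<Longrightarrow> y \<in> AA \<Longrightarrow> p ((x o\<^sub>L y) - (y o\<^sub>L x)) = 0"
begin

lemma diff_le:
  assumes "x \<in> AA" "y \<in> AA"
  shows "p (x - y) \<le> p x + p y"
  using add_le[of x "cscaleL (-1) y"] cscaleL[of y "-1"] assms cscaleL_minus_left[of 1 y]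
  by (simp add: closed_intros cscaleL_one)

lemma le_if_diff_null: "x \<in> AA \<Longrightarrow> y \<in> AA \<Longrightarrow> p (x - y) = 0 \<Longrightarrow> p x \<le> p y"
  using add_le[of "x - y" y] by (simp add: closed_intros)

lemma eq_if_diff_null:
  assumes "x \<in> AA" "y \<in> AA" "p (x - y) = 0"
  shows "p x = p y"
proof (rule antisym)
  show "p x \<le> p y" using assms by (rule le_if_diff_null)
  have "y - x = cscaleL (-1) (x - y)" by (simp add: cscaleL_minus_left cscaleL_one)
  then have "p (y - x) = 0" using cscaleL[of "x - y" "-1"] assms by (simp add: closed_intros)
  with assms(2,1) show "p y \<le> p x" by (rule le_if_diff_null)
qed

lemma scalar_eq_cmod: "p (scalar c) = cmod c"
  by (simp add: cscaleL id_closed id_eq_1)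

lemma compose_commute_middle:
  assumes "w \<in> AA" "x \<in> AA" "y \<in> AA" "z \<in> AA"
  shows "p (w o\<^sub>L (x o\<^sub>L (y o\<^sub>L z))) = p (w o\<^sub>L (y o\<^sub>L (x o\<^sub>L z)))"
proof (rule eq_if_diff_null)
  let ?d = "(x o\<^sub>L y) - (y o\<^sub>L x)"
  have "p (w o\<^sub>L (?d o\<^sub>L z)) \<le> p w * p (?d o\<^sub>L z)" by (intro compose_le closed_intros assms)
  also have "\<dots> \<le> p w * (p ?d * p z)" by (intro mult_left_mono compose_le closed_intros assms nonneg)
  also have "\<dots> = 0" by (simp add: commutator assms)
  finally have "p (w o\<^sub>L (?d o\<^sub>L z)) = 0" by (simp add: antisym)
  then show "p ((w o\<^sub>L (x o\<^sub>L (y o\<^sub>L z))) - (w o\<^sub>L (y o\<^sub>L (x o\<^sub>L z)))) = 0"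
    by (simp add: compose_simps)
qed (intro closed_intros assms)+

lemma opow_power_of_2:
  assumes "x \<in> AA"
  shows "p (opow x (2 ^ n)) = p x ^ (2 ^ n)"
proof (induction n)
  case (Suc n)
  have "opow x (2 ^ Suc n) = opow x (2 ^ n) o\<^sub>L opow x (2 ^ n)" by (simp add: mult_2 flip: opow_add)
  then show ?case
    using Suc assms by (simp add: square opow_closed flip: power_mult) (simp add: mult.commute)
qed simp

end

definition localization ::
  "(('h::real_normed_vector \<Rightarrow>\<^sub>L 'h) \<Rightarrow> real) \<Rightarrow> ('h \<Rightarrow>\<^sub>L 'h) \<Rightarrow> ('h \<Rightarrow>\<^sub>L 'h) \<Rightarrow> real" where
  "localization p a x = (INF m. p (x o\<^sub>L opow a m))"

definition (in unital_operator_algebra) invariant_under ::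
  "('h \<Rightarrow>\<^sub>L 'h) set \<Rightarrow> (('h \<Rightarrow>\<^sub>L 'h) \<Rightarrow> real) \<Rightarrow> bool" where
  "invariant_under G p \<longleftrightarrow> (\<forall>g\<in>G. \<forall>x\<in>AA. p (x o\<^sub>L g) = p x)"

context uniform_seminorm
begin

lemma bdd_below_localization: "bdd_below (range (\<lambda>m. p (x o\<^sub>L opow a m)))"
  by (rule bdd_belowI2[where m=0]) simp

lemma localization_nonneg: "0 \<le> localization p a x"
  unfolding localization_def by (rule cINF_greatest) auto

lemma localization_le: "localization p a \<le> p"
proof (rule le_funI)
  show "localization p a x \<le> p x" for x
    unfolding localization_def using cINF_lower[OF bdd_below_localization, of 0 x a] by simp
qed

context
  fixes a
  assumes a: "a \<in> AA" and pa: "p a = 1"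
begin

lemma decseq_localization:
  assumes x: "x \<in> AA"
  shows "decseq (\<lambda>m. p (x o\<^sub>L opow a m))"
proof (rule decseq_SucI)
  fix m
  have "p (x o\<^sub>L opow a (Suc m)) = p ((x o\<^sub>L opow a m) o\<^sub>L a)"
    by (simp only: opow_Suc_right blinfun_compose_assoc)
  also have "\<dots> \<le> p (x o\<^sub>L opow a m) * p a" by (intro compose_le closed_intros x a)
  finally show "p (x o\<^sub>L opow a (Suc m)) \<le> p (x o\<^sub>L opow a m)" by (simp add: pa)
qed

lemma localization_tendsto: "x \<in> AA \<Longrightarrow> (\<lambda>m. p (x o\<^sub>L opow a m)) \<longlonglongrightarrow> localization p a x"
  unfolding localization_def by (intro LIMSEQ_decseq_INF bdd_below_localization decseq_localization)

lemma opow_eq_1: "p (opow a m) = 1"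
proof (rule antisym)
  have dec: "p (opow a n) \<le> p (opow a m)" if "m \<le> n" for m n
    using decseqD[OF decseq_localization[OF id_closed] that] by simp
  show "p (opow a m) \<le> 1" using dec[of 0 m] by (simp add: id_eq_1)
  show "1 \<le> p (opow a m)"
    using dec[of m "2 ^ m"] opow_power_of_2[OF a, of m] less_exp[of m] by (simp add: pa)
qed

lemma compose_opow_double:
  assumes "x \<in> AA" "y \<in> AA"
  shows "p ((x o\<^sub>L y) o\<^sub>L opow a (m + m)) = p ((x o\<^sub>L opow a m) o\<^sub>L (y o\<^sub>L opow a m))"
  using compose_commute_middle[OF assms opow_closed[OF a] opow_closed[OF a], of m m]
  by (simp add: opow_add blinfun_compose_assoc)

lemma localization_tendsto_double:
  assumes "x \<in> AA"
  shows "(\<lambda>m. p (x o\<^sub>L opow a (m + m))) \<longlonglongrightarrow> localization p a x"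
proof -
  have "strict_mono (\<lambda>m::nat. m + m)" by (rule strict_monoI) simp
  from LIMSEQ_subseq_LIMSEQ[OF localization_tendsto[OF assms] this] show ?thesis
    by (simp add: comp_def)
qed

lemma localization_compose_le:
  assumes "x \<in> AA" "y \<in> AA"
  shows "localization p a (x o\<^sub>L y) \<le> localization p a x * localization p a y"
proof (rule LIMSEQ_le)
  show "(\<lambda>m. p ((x o\<^sub>L y) o\<^sub>L opow a (m + m))) \<longlonglongrightarrow> localization p a (x o\<^sub>L y)"
    by (intro localization_tendsto_double closed_intros assms)
  show "(\<lambda>m. p (x o\<^sub>L opow a m) * p (y o\<^sub>L opow a m)) \<longlonglongrightarrow> localization p a x * localization p a y"
    by (intro tendsto_mult localization_tendsto assms)
  show "\<exists>N. \<forall>m\<ge>N. p ((x o\<^sub>L y) o\<^sub>L opow a (m + m)) \<le> p (x o\<^sub>L opow a m) * p (y o\<^sub>L opow a m)"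
    unfolding compose_opow_double[OF assms]
    by (intro exI allI impI compose_le closed_intros a assms)
qed

lemma localization_square:
  assumes x: "x \<in> AA"
  shows "localization p a (x o\<^sub>L x) = (localization p a x)\<^sup>2"
proof (rule LIMSEQ_unique)
  show "(\<lambda>m. (p (x o\<^sub>L opow a m))\<^sup>2) \<longlonglongrightarrow> localization p a (x o\<^sub>L x)"
    using localization_tendsto_double[OF compose_closed[OF x x]]
    unfolding compose_opow_double[OF x x]
    by (simp add: square closed_intros a x)
  show "(\<lambda>m. (p (x o\<^sub>L opow a m))\<^sup>2) \<longlonglongrightarrow> (localization p a x)\<^sup>2"
    by (intro tendsto_power localization_tendsto x)
qed

lemma uniform_seminorm_localization: "uniform_seminorm AA (localization p a)"
proof unfold_locales
  fix x y and c :: complex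
  assume x: "x \<in> AA"
  show "localization p a (cscaleL c x) = cmod c * localization p a x"
  proof (rule LIMSEQ_unique)
    show "(\<lambda>m. p (cscaleL c x o\<^sub>L opow a m)) \<longlonglongrightarrow> localization p a (cscaleL c x)"
      by (intro localization_tendsto closed_intros x)
    show "(\<lambda>m. p (cscaleL c x o\<^sub>L opow a m)) \<longlonglongrightarrow> cmod c * localization p a x"
      using tendsto_mult_left[OF localization_tendsto[OF x]]
      by (simp add: cscaleL_simps cscaleL closed_intros x a)
  qed
  assume y: "y \<in> AA"
  show "localization p a (x + y) \<le> localization p a x + localization p a y"
  proof (rule LIMSEQ_le)
    show "(\<lambda>m. p ((x + y) o\<^sub>L opow a m)) \<longlonglongrightarrow> localization p a (x + y)"
      by (intro localization_tendsto closed_intros x y)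
    show "(\<lambda>m. p (x o\<^sub>L opow a m) + p (y o\<^sub>L opow a m)) \<longlonglongrightarrow> localization p a x + localization p a y"
      by (intro tendsto_add localization_tendsto x y)
  qed (auto simp: compose_simps intro!: add_le closed_intros a x y)
  show "localization p a ((x o\<^sub>L y) - (y o\<^sub>L x)) = 0"
    using le_funD[OF localization_le, of a "(x o\<^sub>L y) - (y o\<^sub>L x)"] commutator[OF x y]
      localization_nonneg
    by (simp add: antisym)
next
  show "localization p a id_blinfun = 1"
    using localization_tendsto[OF id_closed] by (simp add: opow_eq_1 LIMSEQ_const_iff)
qed (use localization_nonneg localization_compose_le localization_square in auto)

lemma invariant_under_localization:
  assumes G: "G \<subseteq> AA" and inv: "invariant_under G p"
  shows "invariant_under (insert a G) (localization p a)"
  unfolding invariant_under_def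
proof (intro ballI)
  fix g x assume g: "g \<in> insert a G" and x: "x \<in> AA"
  have g_AA: "g \<in> AA" using g a G by auto
  have lim: "(\<lambda>m. p ((x o\<^sub>L g) o\<^sub>L opow a m)) \<longlonglongrightarrow> localization p a (x o\<^sub>L g)"
    by (intro localization_tendsto closed_intros x g_AA)
  consider "g = a" | "g \<in> G" using g by blast
  then show "localization p a (x o\<^sub>L g) = localization p a x"
  proof cases
    case 1
    have "(\<lambda>m. p (x o\<^sub>L opow a (Suc m))) \<longlonglongrightarrow> localization p a x"
      by (rule LIMSEQ_Suc[OF localization_tendsto[OF x]])
    with lim show ?thesis using LIMSEQ_unique by (simp add: 1 blinfun_compose_assoc)
  next
    case 2
    have "p ((x o\<^sub>L g) o\<^sub>L opow a m) = p (x o\<^sub>L opow a m)" for m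
    proof -
      have "p ((x o\<^sub>L g) o\<^sub>L opow a m) = p ((x o\<^sub>L opow a m) o\<^sub>L g)"
        using compose_commute_middle[OF x g_AA opow_closed[OF a] id_closed, of m]
        by (simp add: blinfun_compose_assoc)
      also have "\<dots> = p (x o\<^sub>L opow a m)"
        using inv 2 by (simp add: invariant_under_def closed_intros x a)
      finally show ?thesis .
    qed
    with lim show ?thesis using localization_tendsto[OF x] LIMSEQ_unique by simp
  qed
qed

end

end

lemma chain_tendsto_INF:
  fixes C :: "('a \<Rightarrow> real) set"
  assumes "C \<noteq> {}" and chain: "\<And>p q. p \<in> C \<Longrightarrow> q \<in> C \<Longrightarrow> p \<le> q \<or> q \<le> p"
    and bdd: "\<And>x. bdd_below ((\<lambda>p. p x) ` C)"
  obtains F where "F \<noteq> bot" "\<forall>\<^sub>F p in F. p \<in> C" "\<And>x. ((\<lambda>p. p x) \<longlongrightarrow> (INF p\<in>C. p x)) F"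
proof -
  define F where "F = (INF p\<in>C. principal {q\<in>C. q \<le> p})"
  have ev: "eventually Q F \<longleftrightarrow> (\<exists>p\<in>C. \<forall>q\<in>C. q \<le> p \<longrightarrow> Q q)" for Q
    unfolding F_def
  proof (subst eventually_INF_base)
    fix p q assume "p \<in> C" "q \<in> C"
    then show "\<exists>r\<in>C. principal {s \<in> C. s \<le> r} \<le>
        inf (principal {s \<in> C. s \<le> p}) (principal {s \<in> C. s \<le> q})"
      using chain[of p q] by (auto intro: order_trans)
  qed (use \<open>C \<noteq> {}\<close> in \<open>auto simp: eventually_principal\<close>)
  show thesis
  proof (rule that)
    show "F \<noteq> bot" using ev[of "\<lambda>_. False"] by (auto simp: trivial_limit_def)
    show "\<forall>\<^sub>F p in F. p \<in> C" using ev \<open>C \<noteq> {}\<close> by blast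
    fix x
    let ?u = "INF p\<in>C. p x"
    show "((\<lambda>p. p x) \<longlongrightarrow> ?u) F"
    proof (rule order_tendstoI)
      fix l assume "l < ?u"
      then have "l < p x" if "p \<in> C" for p using cINF_lower[OF bdd that, of x] by linarith
      then show "\<forall>\<^sub>F p in F. l < p x" using ev \<open>C \<noteq> {}\<close> by blast
    next
      fix r assume "?u < r"
      then obtain p where "p \<in> C" "p x < r" using cINF_less_iff[OF \<open>C \<noteq> {}\<close> bdd] by blast
      then show "\<forall>\<^sub>F p in F. p x < r" unfolding ev by (meson le_funD le_less_trans)
    qed
  qed
qed

context unital_operator_algebra
begin

lemma uniform_seminorm_tendsto:
  assumes F: "F \<noteq> bot" and ev: "\<forall>\<^sub>F p in F. uniform_seminorm AA p"
    and lim: "\<And>x. ((\<lambda>p. p x) \<longlongrightarrow> u x) F"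
  shows "uniform_seminorm AA u"
proof unfold_locales
  fix x y and c :: complex
  show "0 \<le> u x"
    by (rule tendsto_lowerbound[OF lim _ F])
      (use ev in \<open>auto elim!: eventually_mono simp: uniform_seminorm.nonneg\<close>)
  assume x: "x \<in> AA"
  have "((\<lambda>p. p (cscaleL c x)) \<longlongrightarrow> cmod c * u x) F"
    by (rule Lim_transform_eventually[OF tendsto_mult_left[OF lim]])
      (use ev x in \<open>auto elim!: eventually_mono simp: uniform_seminorm.cscaleL\<close>)
  then show "u (cscaleL c x) = cmod c * u x" using tendsto_unique[OF F lim] by blast
  have "((\<lambda>p. p (x o\<^sub>L x)) \<longlongrightarrow> (u x)\<^sup>2) F"
    by (rule Lim_transform_eventually[OF tendsto_power[OF lim]])
      (use ev x in \<open>auto elim!: eventually_mono simp: uniform_seminorm.square\<close>)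
  then show "u (x o\<^sub>L x) = (u x)\<^sup>2" using tendsto_unique[OF F lim] by blast
  assume y: "y \<in> AA"
  show "u (x + y) \<le> u x + u y"
    by (rule tendsto_le[OF F tendsto_add[OF lim lim] lim])
      (use ev x y in \<open>auto elim!: eventually_mono simp: uniform_seminorm.add_le\<close>)
  show "u (x o\<^sub>L y) \<le> u x * u y"
    by (rule tendsto_le[OF F tendsto_mult[OF lim lim] lim])
      (use ev x y in \<open>auto elim!: eventually_mono simp: uniform_seminorm.compose_le\<close>)
  have "((\<lambda>p. p ((x o\<^sub>L y) - (y o\<^sub>L x))) \<longlongrightarrow> 0) F"
    by (rule Lim_transform_eventually[OF tendsto_const])
      (use ev x y in \<open>auto elim!: eventually_mono simp: uniform_seminorm.commutator\<close>)
  then show "u ((x o\<^sub>L y) - (y o\<^sub>L x)) = 0" using tendsto_unique[OF F lim] by blast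
next
  have "((\<lambda>p. p id_blinfun) \<longlongrightarrow> 1) F"
    by (rule Lim_transform_eventually[OF tendsto_const])
      (use ev in \<open>auto elim!: eventually_mono simp: uniform_seminorm.id_eq_1\<close>)
  then show "u id_blinfun = 1" using tendsto_unique[OF F lim] by blast
qed

lemma invariant_under_tendsto:
  assumes F: "F \<noteq> bot" and ev: "\<forall>\<^sub>F p in F. invariant_under G p"
    and lim: "\<And>x. ((\<lambda>p. p x) \<longlongrightarrow> u x) F"
  shows "invariant_under G u"
  unfolding invariant_under_def
proof (intro ballI)
  fix g x assume "g \<in> G" "x \<in> AA"
  then have "((\<lambda>p. p (x o\<^sub>L g)) \<longlongrightarrow> u x) F"
    by (intro Lim_transform_eventually[OF lim])
      (use ev in \<open>auto elim!: eventually_mono simp: invariant_under_def\<close>)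
  then show "u (x o\<^sub>L g) = u x" using tendsto_unique[OF F lim] by blast
qed

lemma uniform_seminorm_INF_chain:
  assumes "C \<noteq> {}" and chain: "\<And>q r. q \<in> C \<Longrightarrow> r \<in> C \<Longrightarrow> q \<le> r \<or> r \<le> q"
    and C: "\<And>q. q \<in> C \<Longrightarrow> uniform_seminorm AA q" "\<And>q. q \<in> C \<Longrightarrow> invariant_under G q"
  defines "u \<equiv> \<lambda>x. INF q\<in>C. q x"
  shows "uniform_seminorm AA u" "invariant_under G u" "\<And>q. q \<in> C \<Longrightarrow> u \<le> q"
proof -
  have bdd: "bdd_below ((\<lambda>q. q x) ` C)" for x
    by (rule bdd_belowI2[where m=0]) (intro uniform_seminorm.nonneg[OF C(1)])
  obtain F where F: "F \<noteq> bot" "\<forall>\<^sub>F q in F. q \<in> C" and lim: "\<And>x. ((\<lambda>q. q x) \<longlongrightarrow> u x) F"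
    using chain_tendsto_INF[OF \<open>C \<noteq> {}\<close> chain bdd] unfolding u_def by blast
  show "uniform_seminorm AA u"
    by (rule uniform_seminorm_tendsto[OF F(1) eventually_mono[OF F(2) C(1)] lim])
  show "invariant_under G u"
    by (rule invariant_under_tendsto[OF F(1) eventually_mono[OF F(2) C(2)] lim])
  show "u \<le> q" if "q \<in> C" for q
    unfolding u_def by (intro le_funI cINF_lower bdd that)
qed

lemma exists_minimal_uniform_seminorm:
  assumes "uniform_seminorm AA p" "invariant_under G p"
  obtains q where "uniform_seminorm AA q" "invariant_under G q"
    "\<And>r. uniform_seminorm AA r \<Longrightarrow> invariant_under G r \<Longrightarrow> r \<le> q \<Longrightarrow> r = q"
proof -
  let ?S = "{q. uniform_seminorm AA q \<and> invariant_under G q}"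
  have "\<exists>m\<in>?S. \<forall>q\<in>?S. m \<ge> q \<longrightarrow> q = m"
  proof (rule predicate_Zorn)
    show "partial_order_on ?S (relation_of (\<ge>) ?S)"
      by (rule partial_order_on_relation_ofI) auto
    fix C assume C: "C \<in> Chains (relation_of (\<ge>) ?S)"
    have C_sub: "C \<subseteq> ?S" and chain: "\<And>q r. q \<in> C \<Longrightarrow> r \<in> C \<Longrightarrow> q \<le> r \<or> r \<le> q"
      using C by (auto simp: Chains_def relation_of_def)
    show "\<exists>u\<in>?S. \<forall>q\<in>C. q \<ge> u"
    proof (cases "C = {}")
      case True
      then show ?thesis using assms by auto
    next
      case False
      then show ?thesis using uniform_seminorm_INF_chain[OF False chain, of G] C_sub by blast
    qed
  qed
  then show thesis using that by blast
qed

end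

section \<open>Multiplicative seminorms and characters\<close>

locale multiplicative_seminorm = uniform_seminorm +
  assumes compose: "x \<in> AA \<Longrightarrow> y \<in> AA \<Longrightarrow> p (x o\<^sub>L y) = p x * p y"

lemma (in uniform_seminorm) minimal_imp_multiplicative:
  assumes G: "G \<subseteq> AA" and inv: "invariant_under G p"
    and min: "\<And>q. uniform_seminorm AA q \<Longrightarrow> invariant_under G q \<Longrightarrow> q \<le> p \<Longrightarrow> q = p"
  shows "multiplicative_seminorm AA p"
proof unfold_locales
  fix x y assume x: "x \<in> AA" and y: "y \<in> AA"
  show "p (x o\<^sub>L y) = p x * p y"
  proof (cases "p y = 0")
    case True
    then show ?thesis using compose_le[OF x y] by (simp add: antisym)
  next
    case False
    define a where "a = cscaleL (of_real (1 / p y)) y"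
    have a: "a \<in> AA" "p a = 1" using False y by (auto simp: a_def cscaleL norm_divide closed_intros)
    have inv_a: "invariant_under (insert a G) (localization p a)"
      by (rule invariant_under_localization[OF a G inv])
    then have "invariant_under G (localization p a)" by (simp add: invariant_under_def)
    then have "localization p a = p" by (intro min uniform_seminorm_localization a localization_le)
    with inv_a have "p (x o\<^sub>L a) = p x" using x by (simp add: invariant_under_def)
    moreover have "x o\<^sub>L a = cscaleL (of_real (1 / p y)) (x o\<^sub>L y)"
      unfolding a_def by (intro BH_compose_cscaleL in_BH x)
    ultimately have "(1 / p y) * p (x o\<^sub>L y) = p x"
      by (simp add: cscaleL closed_intros x y norm_divide)
    then show ?thesis using False by (simp add: field_simps)
  qed
qed

context multiplicative_seminorm
begin

lemma opow_double_minus_scalar: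
  assumes "x \<in> AA"
  shows "p (opow x (2 ^ Suc k) - scalar (c * c)) =
    p (opow x (2 ^ k) - scalar c) * p (opow x (2 ^ k) - scalar (- c))"
proof -
  let ?y = "opow x (2 ^ k)"
  have y: "?y \<in> AA" by (rule opow_closed[OF assms])
  have "opow x (2 ^ Suc k) - scalar (c * c) = (?y o\<^sub>L ?y) - scalar (c * c)"
    by (simp add: mult_2 flip: opow_add)
  also have "\<dots> = (?y - scalar c) o\<^sub>L (?y - scalar (- c))"
    using in_BH[OF y] by (simp add: compose_simps BH_compose_cscaleL BH.closed_intros cscaleL_simps)
  also have "p \<dots> = p (?y - scalar c) * p (?y - scalar (- c))" by (intro compose closed_intros y)
  finally show ?thesis .
qed

lemma power_le_opow_minus_scalar:
  assumes x: "x \<in> AA" and m: "0 \<le> m" and low: "\<And>d. m \<le> p (x - scalar d)"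
  shows "m ^ (2 ^ k) \<le> p (opow x (2 ^ k) - scalar d)"
proof (induction k arbitrary: d)
  case 0
  then show ?case using low by simp
next
  case (Suc k)
  have "m ^ (2 ^ Suc k) = m ^ (2 ^ k) * m ^ (2 ^ k)" by (simp add: mult_2 power_add)
  also have "\<dots> \<le> p (opow x (2 ^ k) - scalar (csqrt d)) * p (opow x (2 ^ k) - scalar (- csqrt d))"
    by (intro mult_mono Suc) (use m in auto)
  also have "\<dots> = p (opow x (2 ^ Suc k) - scalar (csqrt d * csqrt d))"
    by (rule opow_double_minus_scalar[OF x, symmetric])
  finally show ?case by (simp flip: power2_eq_square)
qed

lemma minus_scalar_mult_power_le:
  assumes x: "x \<in> AA" and m: "0 \<le> m" and low: "\<And>d. m \<le> p (x - scalar d)"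
  shows "p (x - scalar c) * m ^ (2 ^ k) \<le> m * p (opow x (2 ^ k) - scalar (c ^ (2 ^ k)))"
proof (induction k)
  case 0
  then show ?case by simp
next
  case (Suc k)
  let ?y = "opow x (2 ^ k)" and ?c = "c ^ (2 ^ k)"
  have "p (x - scalar c) * m ^ (2 ^ Suc k) = (p (x - scalar c) * m ^ (2 ^ k)) * m ^ (2 ^ k)"
    by (simp add: mult_2 power_add)
  also have "\<dots> \<le> (m * p (?y - scalar ?c)) * p (?y - scalar (- ?c))"
    by (intro mult_mono Suc power_le_opow_minus_scalar x m low) (use m in auto)
  also have "\<dots> = m * p (opow x (2 ^ Suc k) - scalar (?c * ?c))"
    by (simp only: opow_double_minus_scalar[OF x] mult.assoc)
  finally show ?case by (simp add: mult_2 power_add)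
qed

text \<open>The factorisation of \<open>x\<^sup>n - c\<^sup>n\<close> with \<open>n = 2\<^sup>k\<close> and minimality of \<open>m = p x\<close> give
  \<open>p (x - c) m\<^sup>n \<le> m (m\<^sup>n + \<bar>c\<bar>\<^sup>n)\<close>, hence \<open>p (x - c) \<le> m\<close> as \<open>n \<rightarrow> \<infinity>\<close>.\<close>

lemma minimal_distance_spreads:
  assumes x: "x \<in> AA" and min: "\<And>d. p x \<le> p (x - scalar d)" and c: "cmod c < p x"
  shows "p (x - scalar c) = p x"
proof (rule antisym)
  define m where "m = p x"
  have m: "m > 0" and q: "cmod c / m < 1"
    using c norm_ge_zero[of c] by (auto simp: m_def simp del: norm_ge_zero)
  have "p (x - scalar c) \<le> m * (1 + (cmod c / m) ^ (2 ^ k))" for k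
  proof -
    have "p (x - scalar c) * m ^ (2 ^ k) \<le> m * p (opow x (2 ^ k) - scalar (c ^ (2 ^ k)))"
      using x min unfolding m_def by (intro minus_scalar_mult_power_le) auto
    also have "\<dots> \<le> m * (p (opow x (2 ^ k)) + p (scalar (c ^ (2 ^ k))))"
      by (intro mult_left_mono diff_le closed_intros x) (use m in simp)
    also have "\<dots> = m * (1 + (cmod c / m) ^ (2 ^ k)) * m ^ (2 ^ k)"
      using m
      by (simp add: opow_power_of_2 x scalar_eq_cmod norm_power power_divide field_simps m_def)
    finally show ?thesis using m by simp
  qed
  moreover have "(\<lambda>k. m * (1 + (cmod c / m) ^ (2 ^ k))) \<longlonglongrightarrow> m * (1 + 0)"
  proof -
    have "strict_mono (\<lambda>k::nat. 2 ^ k :: nat)" by (rule strict_monoI) simp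
    moreover have "(\<lambda>n. (cmod c / m) ^ n) \<longlonglongrightarrow> 0" using m q by (intro LIMSEQ_realpow_zero) auto
    ultimately have "(\<lambda>k. (cmod c / m) ^ (2 ^ k)) \<longlonglongrightarrow> 0"
      using LIMSEQ_subseq_LIMSEQ by (fastforce simp: comp_def)
    then show ?thesis by (intro tendsto_intros)
  qed
  ultimately show "p (x - scalar c) \<le> p x" unfolding m_def[symmetric]
    by (intro LIMSEQ_le_const[where X="\<lambda>k. m * (1 + (cmod c / m) ^ (2 ^ k))"]) auto
qed (rule min)

lemma lipschitz_minus_scalar:
  assumes a: "a \<in> AA"
  shows "1-lipschitz_on UNIV (\<lambda>c. p (a - scalar c))"
proof (rule lipschitz_onI)
  have "p (a - scalar c) \<le> p (a - scalar d) + dist c d" for c d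
  proof -
    have "a - scalar c = (a - scalar d) - scalar (c - d)" by (simp add: cscaleL_simps)
    also have "p \<dots> \<le> p (a - scalar d) + p (scalar (c - d))" by (intro diff_le closed_intros a)
    finally show ?thesis by (simp add: scalar_eq_cmod dist_norm)
  qed
  from this[of c d for c d] show "dist (p (a - scalar c)) (p (a - scalar d)) \<le> 1 * dist c d" for c d
    using dist_commute[of c d] by (smt (verit) dist_real_def)
qed simp

lemma minus_scalar_ge:
  assumes "a \<in> AA"
  shows "cmod c - p a \<le> p (a - scalar c)"
  using diff_le[of a "a - scalar c"] assms by (simp add: closed_intros scalar_eq_cmod)

lemma minus_scalar_attains_inf:
  assumes a: "a \<in> AA"
  obtains c where "\<And>d. p (a - scalar c) \<le> p (a - scalar d)"
proof -
  have "continuous_on (cball 0 (2 * p a)) (\<lambda>c. p (a - scalar c))"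
    using lipschitz_on_continuous_on[OF lipschitz_minus_scalar[OF a]]
    by (rule continuous_on_subset) simp
  then have "\<exists>c\<in>cball 0 (2 * p a). \<forall>d\<in>cball 0 (2 * p a). p (a - scalar c) \<le> p (a - scalar d)"
    by (intro continuous_attains_inf) (simp_all add: not_less)
  then obtain c where c: "\<And>d. cmod d \<le> 2 * p a \<Longrightarrow> p (a - scalar c) \<le> p (a - scalar d)"
    by (meson mem_cball_0)
  have "p (a - scalar c) \<le> p (a - scalar d)" for d
  proof (cases "cmod d \<le> 2 * p a")
    case False
    have "p (a - scalar c) \<le> p a" using c[of 0] by (simp add: cscaleL_simps)
    then show ?thesis using False minus_scalar_ge[OF a, of d] by linarith
  qed (rule c)
  then show thesis by (rule that)
qed

text \<open>If the minimal distance were positive, the set where it is attained would be open and closed,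
  hence the whole plane, although the distance is unbounded.\<close>

lemma gelfand_mazur:
  assumes a: "a \<in> AA"
  obtains c where "p (a - scalar c) = 0"
proof -
  let ?N = "\<lambda>c. p (a - scalar c)"
  obtain c\<^sub>0 where min: "\<And>d. ?N c\<^sub>0 \<le> ?N d" using minus_scalar_attains_inf[OF a] by blast
  define M where "M = {c. ?N c = ?N c\<^sub>0}"
  have "?N c\<^sub>0 = 0"
  proof (rule ccontr)
    assume "?N c\<^sub>0 \<noteq> 0"
    then have pos: "?N c\<^sub>0 > 0" using nonneg[of "a - scalar c\<^sub>0"] by linarith
    have "open M"
      unfolding open_contains_ball
    proof (intro ballI exI conjI subsetI)
      fix c d assume c: "c \<in> M" and d: "d \<in> ball c (?N c\<^sub>0)"
      have shift: "(a - scalar c) - scalar e = a - scalar (c + e)" for e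
        by (simp add: cscaleL_simps)
      have "p ((a - scalar c) - scalar (d - c)) = p (a - scalar c)"
        by (rule minimal_distance_spreads)
          (use c d a min in \<open>auto simp: M_def shift dist_norm norm_minus_commute intro: closed_intros\<close>)
      then show "d \<in> M" using c by (simp add: shift M_def)
    qed (rule pos)
    moreover have "closed M"
      unfolding M_def using lipschitz_on_continuous_on[OF lipschitz_minus_scalar[OF a]]
      by (intro closed_Collect_eq continuous_on_const)
    ultimately have "M = UNIV" using clopen[of M] by (auto simp: M_def)
    then have "?N (of_real (?N c\<^sub>0 + p a + 1)) = ?N c\<^sub>0" by (auto simp: M_def)
    moreover have "cmod (of_real (?N c\<^sub>0 + p a + 1)) = ?N c\<^sub>0 + p a + 1"
      unfolding norm_of_real using nonneg[of a] pos by linarith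
    ultimately show False using minus_scalar_ge[OF a, of "of_real (?N c\<^sub>0 + p a + 1)"] by linarith
  qed
  then show thesis by (rule that)
qed

lemma scalar_part_unique:
  assumes "a \<in> AA" "p (a - scalar c) = 0" "p (a - scalar d) \<le> 0"
  shows "c = d"
proof -
  have "cmod (c - d) = p ((a - scalar d) - (a - scalar c))"
    by (simp add: cscaleL_simps flip: scalar_eq_cmod)
  also have "\<dots> \<le> p (a - scalar d) + p (a - scalar c)" by (intro diff_le closed_intros assms)
  finally have "cmod (c - d) \<le> 0" using assms(2,3) by linarith
  then show ?thesis by simp
qed

lemma exists_character_eq_seminorm:
  obtains \<kappa> where "character AA \<kappa>" "\<And>a. a \<in> AA \<Longrightarrow> cmod (\<kappa> a) = p a"
proof -
  have "\<forall>a\<in>AA. \<exists>c. p (a - scalar c) = 0" using gelfand_mazur by blast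
  then obtain \<kappa> where \<kappa>: "\<And>a. a \<in> AA \<Longrightarrow> p (a - scalar (\<kappa> a)) = 0" by metis
  have eqI: "\<kappa> a = c" if "a \<in> AA" "p (a - scalar c) \<le> 0" for a c
    using scalar_part_unique[OF that(1) \<kappa>[OF that(1)] that(2)] .
  have "character AA \<kappa>" unfolding character_def clinear_on_def
  proof (intro conjI ballI allI)
    fix a b and c :: complex assume a: "a \<in> AA"
    let ?r = "\<lambda>x. x - scalar (\<kappa> x)"
    have r: "?r x \<in> AA" if "x \<in> AA" for x by (intro closed_intros that)
    have "cscaleL c a - scalar (c * \<kappa> a) = cscaleL c (?r a)" by (simp add: cscaleL_simps)
    then show "\<kappa> (cscaleL c a) = c * \<kappa> a"
      by (intro eqI closed_intros a) (simp add: cscaleL r \<kappa> a)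
    assume b: "b \<in> AA"
    have "(a + b) - scalar (\<kappa> a + \<kappa> b) = ?r a + ?r b" by (simp add: cscaleL_simps)
    then have "p ((a + b) - scalar (\<kappa> a + \<kappa> b)) \<le> p (?r a) + p (?r b)"
      using add_le[OF r[OF a] r[OF b]] by (simp only:)
    then show "\<kappa> (a + b) = \<kappa> a + \<kappa> b" by (intro eqI closed_intros a b) (simp only: \<kappa> a b)
    have "(a o\<^sub>L b) - scalar (\<kappa> a * \<kappa> b) = (?r a o\<^sub>L b) + cscaleL (\<kappa> a) (?r b)"
      by (simp add: compose_simps cscaleL_simps)
    then have "p ((a o\<^sub>L b) - scalar (\<kappa> a * \<kappa> b)) \<le> p (?r a) * p b + cmod (\<kappa> a) * p (?r b)"
      using add_le[of "?r a o\<^sub>L b" "cscaleL (\<kappa> a) (?r b)"]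
      by (simp add: closed_intros compose cscaleL r a b)
    then show "\<kappa> (a o\<^sub>L b) = \<kappa> a * \<kappa> b" by (intro eqI closed_intros a b) (simp add: \<kappa> a b)
  next
    show "\<kappa> id_blinfun = 1"
      using scalar_eq_cmod[of 0] by (intro eqI id_closed) (simp add: cscaleL_simps)
  qed
  moreover have "cmod (\<kappa> a) = p a" if a: "a \<in> AA" for a
    using eq_if_diff_null[OF a _ \<kappa>[OF a]] by (simp add: scalar_eq_cmod closed_intros)
  ultimately show thesis by (rule that)
qed

end

text \<open>Invariance under \<open>b / p b\<close> fixes the value at \<open>b\<close>, and it survives the passage to a minimal
  seminorm.\<close>

lemma (in uniform_seminorm) exists_character_attaining:
  assumes G: "G \<subseteq> AA" and inv: "invariant_under G p" and b: "b \<in> AA" "p b \<noteq> 0"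
  obtains \<kappa> where "character AA \<kappa>" "\<And>g. g \<in> G \<Longrightarrow> cmod (\<kappa> g) = 1" "cmod (\<kappa> b) = p b"
proof -
  define a where "a = cscaleL (of_real (1 / p b)) b"
  have a: "a \<in> AA" "p a = 1" using b by (auto simp: a_def cscaleL norm_divide closed_intros)
  have aG: "insert a G \<subseteq> AA" using a G by blast
  obtain q where q: "uniform_seminorm AA q" "invariant_under (insert a G) q"
    and min: "\<And>r. uniform_seminorm AA r \<Longrightarrow> invariant_under (insert a G) r \<Longrightarrow> r \<le> q \<Longrightarrow> r = q"
    using exists_minimal_uniform_seminorm
      [OF uniform_seminorm_localization[OF a] invariant_under_localization[OF a G inv]] by blast
  interpret q: multiplicative_seminorm AA q
    by (rule uniform_seminorm.minimal_imp_multiplicative[OF q(1) aG q(2) min])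
  obtain \<kappa> where \<kappa>: "character AA \<kappa>" "\<And>a. a \<in> AA \<Longrightarrow> cmod (\<kappa> a) = q a"
    using q.exists_character_eq_seminorm by blast
  have q_1: "q g = 1" if "g \<in> insert a G" for g
    using q(2) that q.id_eq_1 by (metis invariant_under_def blinfun_compose_id(1) id_closed)
  have "\<kappa> a = of_real (1 / p b) * \<kappa> b"
    using \<kappa>(1) b unfolding a_def character_def clinear_on_def by blast
  then have "\<kappa> b = of_real (p b) * \<kappa> a" using b by simp
  then have "cmod (\<kappa> b) = p b" using \<kappa>(2)[OF a(1)] q_1[of a] by (simp add: norm_mult)
  moreover have "cmod (\<kappa> g) = 1" if "g \<in> G" for g using \<kappa>(2) q_1 that G by auto
  ultimately show thesis using that \<kappa>(1) by blast
qed

section \<open>Peaking elements and characteristic sequences\<close>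

lemma (in unital_operator_algebra) character_minus_scalar:
  assumes "character AA \<omega>" "a \<in> AA"
  shows "\<omega> (a - scalar (\<omega> a)) = 0"
proof -
  have "\<omega> (a + cscaleL (- \<omega> a) id_blinfun) = 0"
    using assms by (simp add: character_def clinear_on_def id_closed cscaleL_closed)
  then show ?thesis by (simp add: cscaleL_minus_left)
qed

definition peaks_at ::
  "('h::chilbert \<Rightarrow>\<^sub>L 'h) set \<Rightarrow> (('h \<Rightarrow>\<^sub>L 'h) \<Rightarrow> complex) \<Rightarrow> ('h \<Rightarrow>\<^sub>L 'h) \<Rightarrow> bool" where
  "peaks_at A \<omega> t \<longleftrightarrow> \<omega> t = 1 \<and>
    (\<forall>\<kappa>. character A \<kappa> \<and> (\<exists>a\<in>A. \<kappa> a \<noteq> \<omega> a) \<longrightarrow> cmod (\<kappa> t) < 1)"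

lemma pure_contraction_conjugate_tendsto_0:
  assumes t: "pure_contraction t" and ess: "(\<lambda>m. essnorm (b o\<^sub>L opow t m)) \<longlonglongrightarrow> 0"
  shows "(\<lambda>n. norm (adjL (opow t n) o\<^sub>L b o\<^sub>L opow t n)) \<longlonglongrightarrow> 0"
proof (rule tendstoI)
  let ?S = "\<lambda>n. adjL (opow t n)"
  have contr: "norm (opow t n) \<le> 1" "norm (?S n) \<le> 1" for n
    using t norm_opow_le_1[of t n] by (auto simp: pure_contraction_def)
  fix e :: real assume e: "e > 0"
  have "\<forall>\<^sub>F m in sequentially. essnorm (b o\<^sub>L opow t m) < e/2"
    using ess e by (intro order_tendstoD) auto
  then obtain m where "essnorm (b o\<^sub>L opow t m) < e/2" by (auto simp: eventually_sequentially)
  then obtain k where k: "k \<in> Kset" "norm ((b o\<^sub>L opow t m) + k) < e/2" using essnorm_lessD by blast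
  have "(\<lambda>n. ?S n x) \<longlonglongrightarrow> 0" for x
    using t by (simp add: pure_contraction_def adjL_opow opow_apply)
  then have "(\<lambda>n. ?S n o\<^sub>L k) \<longlonglongrightarrow> 0"
    using k(1) contr(2) by (intro strong_null_compose_compact_op) (auto simp: Kset_def)
  then have "\<forall>\<^sub>F n in sequentially. norm (?S n o\<^sub>L k) < e/2"
    using e by (intro order_tendstoD(2)[OF tendsto_norm_zero]) auto
  with eventually_ge_at_top[of m]
  show "\<forall>\<^sub>F n in sequentially. dist (norm (?S n o\<^sub>L b o\<^sub>L opow t n)) 0 < e"
  proof eventually_elim
    case (elim n)
    define r where "r = n - m"
    have split: "opow t n = opow t m o\<^sub>L opow t r" using elim(1) by (simp add: r_def flip: opow_add)
    have "?S n o\<^sub>L b o\<^sub>L opow t n = ((?S n o\<^sub>L ((b o\<^sub>L opow t m) + k)) - (?S n o\<^sub>L k)) o\<^sub>L opow t r"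
      by (simp add: split compose_simps)
    also have "norm \<dots> \<le> norm ((?S n o\<^sub>L ((b o\<^sub>L opow t m) + k)) - (?S n o\<^sub>L k))"
      by (rule norm_compose_contraction(2)[OF contr(1)])
    also have "\<dots> \<le> norm (?S n o\<^sub>L ((b o\<^sub>L opow t m) + k)) + norm (?S n o\<^sub>L k)"
      by (rule norm_triangle_ineq4)
    also have "\<dots> \<le> norm ((b o\<^sub>L opow t m) + k) + norm (?S n o\<^sub>L k)"
      by (intro add_right_mono norm_compose_contraction contr)
    also have "\<dots> < e/2 + e/2" by (intro add_strict_mono k elim)
    finally show ?case by simp
  qed
qed

locale essentially_commutative_cstar_algebra = cstar_algebra +
  assumes commutator_Kset: "a \<in> AA \<Longrightarrow> b \<in> AA \<Longrightarrow> (a o\<^sub>L b) - (b o\<^sub>L a) \<in> Kset"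
begin

lemma uniform_seminorm_essnorm:
  assumes "essnorm (id_blinfun :: 'a \<Rightarrow>\<^sub>L 'a) = 1"
  shows "uniform_seminorm AA essnorm"
  by unfold_locales
    (auto simp: assms essnorm_cscaleL essnorm_Kset commutator_Kset adjL_closed in_BH
      intro!: essnorm_add essnorm_compose essnorm_square)

lemma essnorm_compose_opow_tendsto_0:
  assumes \<omega>: "\<omega> id_blinfun = 1" "\<And>a. a \<in> AA \<Longrightarrow> cmod (\<omega> a) \<le> essnorm a"
    and t: "t \<in> AA" "norm t \<le> 1" "peaks_at AA \<omega> t" and b: "b \<in> AA" "\<omega> b = 0"
  shows "(\<lambda>m. essnorm (b o\<^sub>L opow t m)) \<longlonglongrightarrow> 0"
proof -
  have essnorm_1: "essnorm a = 1" if "a \<in> AA" "norm a \<le> 1" "\<omega> a = 1" for a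
    using \<omega>(2)[OF that(1)] essnorm_le_norm[of a] that by simp
  interpret ess: uniform_seminorm AA essnorm
    by (intro uniform_seminorm_essnorm essnorm_1 id_closed norm_blinfun_id_le \<omega>)
  have ess_t: "essnorm t = 1" using t by (intro essnorm_1) (auto simp: peaks_at_def)
  define p where "p = localization essnorm t"
  interpret p: uniform_seminorm AA p
    unfolding p_def by (rule ess.uniform_seminorm_localization[OF t(1) ess_t])
  have "invariant_under {} essnorm" by (simp add: invariant_under_def)
  then have inv: "invariant_under {t} p"
    unfolding p_def by (intro ess.invariant_under_localization t ess_t) auto
  have "p b = 0"
  proof (rule ccontr)
    assume "p b \<noteq> 0"
    then obtain \<kappa> where \<kappa>: "character AA \<kappa>" "cmod (\<kappa> t) = 1" "cmod (\<kappa> b) = p b"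
      using p.exists_character_attaining[OF _ inv b(1)] t(1) by blast
    then have "\<kappa> b \<noteq> \<omega> b" using \<open>p b \<noteq> 0\<close> b(2) by auto
    then show False using t(3) \<kappa> b(1) by (force simp: peaks_at_def)
  qed
  then show ?thesis using ess.localization_tendsto[OF t(1) ess_t b(1)] by (simp add: p_def)
qed

lemma limsup_conjugate_opow_le:
  assumes char: "character AA \<omega>" and bound: "\<And>a. a \<in> AA \<Longrightarrow> cmod (\<omega> a) \<le> essnorm a"
    and t: "t \<in> AA" "pure_contraction t" "peaks_at AA \<omega> t" and a: "a \<in> AA"
  shows "limsup (\<lambda>n. ereal (norm (adjL (opow t n) o\<^sub>L a o\<^sub>L opow t n))) \<le> ereal (cmod (\<omega> a))"
proof -
  let ?b = "a - scalar (\<omega> a)" and ?S = "\<lambda>n. adjL (opow t n)"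
  have norm_t: "norm t \<le> 1" using t by (simp add: pure_contraction_def)
  have "\<omega> id_blinfun = 1" using char by (simp add: character_def)
  then have null: "(\<lambda>n. norm (?S n o\<^sub>L ?b o\<^sub>L opow t n)) \<longlonglongrightarrow> 0"
    by (intro pure_contraction_conjugate_tendsto_0 essnorm_compose_opow_tendsto_0[where \<omega>=\<omega>]
        character_minus_scalar char bound t norm_t closed_intros a)
  have "norm (?S n o\<^sub>L a o\<^sub>L opow t n) \<le> cmod (\<omega> a) + norm (?S n o\<^sub>L ?b o\<^sub>L opow t n)" for n
  proof -
    have "?S n \<in> BH" by (intro in_BH closed_intros t)
    then have "?S n o\<^sub>L a o\<^sub>L opow t n =
        cscaleL (\<omega> a) (?S n o\<^sub>L opow t n) + (?S n o\<^sub>L ?b o\<^sub>L opow t n)"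
      by (simp add: compose_simps cscaleL_simps BH_compose_cscaleL)
    moreover have "norm (cscaleL (\<omega> a) (?S n o\<^sub>L opow t n)) \<le> cmod (\<omega> a)"
      using norm_opow_le_1[OF norm_t, of n]
      by (simp add: norm_adjL_compose power_le_one mult_left_le)
    ultimately show ?thesis by (metis norm_triangle_mono order_refl)
  qed
  then have "limsup (\<lambda>n. ereal (norm (?S n o\<^sub>L a o\<^sub>L opow t n)))
      \<le> limsup (\<lambda>n. ereal (cmod (\<omega> a) + norm (?S n o\<^sub>L ?b o\<^sub>L opow t n)))"
    by (intro Limsup_mono) simp
  also have "\<dots> = ereal (cmod (\<omega> a) + 0)"
    by (intro lim_imp_Limsup sequentially_bot tendsto_intros null)
  finally show ?thesis by simp
qed

lemma characteristic_sequence_opow: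
  assumes char: "character AA \<omega>" and bound: "\<And>a. a \<in> AA \<Longrightarrow> cmod (\<omega> a) \<le> essnorm a"
    and t: "t \<in> AA" "pure_contraction t" "peaks_at AA \<omega> t"
  shows "characteristic_sequence AA \<omega> (opow t)"
proof -
  have \<omega>_opow: "\<omega> (opow t n) = 1" for n
    by (induction n) (use char t in \<open>simp_all add: character_def peaks_at_def opow_closed\<close>)
  have "norm (opow t n) \<le> 1" for n
    using t by (intro norm_opow_le_1) (simp add: pure_contraction_def)
  moreover have "1 \<le> norm (opow t n)" for n
    using bound[OF opow_closed[OF t(1)], of n] essnorm_le_norm[of "opow t n"] by (simp add: \<omega>_opow)
  ultimately have "norm (opow t n) = 1" for n by (intro antisym)
  then show ?thesis
    unfolding characteristic_sequence_def
    using limsup_conjugate_opow_le[OF char bound t] by (simp add: \<omega>_opow opow_closed t)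
qed

lemma character_pure_state:
  assumes pure: "pure_state AA \<psi>" and null: "\<And>k. k \<in> Kset \<Longrightarrow> \<psi> k = 0"
  shows "character AA \<psi>"
proof -
  interpret cstar_pure_state AA \<psi> by unfold_locales (rule pure)
  have "\<psi> (a o\<^sub>L b) = \<psi> (b o\<^sub>L a)" if "a \<in> AA" "b \<in> AA" for a b
    using null[OF commutator_Kset[OF that]] that by (simp add: state_diff closed_intros)
  then have "\<psi> (a o\<^sub>L b) = \<psi> a * \<psi> b" if "a \<in> AA" "b \<in> AA" for a b
    using that by (intro trace_multiplicative) auto
  then show ?thesis using state by (simp add: character_def state_def)
qed

end

lemma Kset_subset_opsys_plus_K: "0 \<in> A \<Longrightarrow> k \<in> Kset \<Longrightarrow> k \<in> opsys_plus_K A"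
  unfolding opsys_plus_K_def by (intro CollectI exI[of _ 0] exI[of _ k]) simp

lemma subset_opsys_plus_K: "0 \<in> A \<Longrightarrow> a \<in> A \<Longrightarrow> a \<in> opsys_plus_K A"
  unfolding opsys_plus_K_def
  by (intro CollectI exI[of _ a] exI[of _ 0]) (simp add: subspace_0[OF subspace_Kset])

theorem theorem4p5:
  fixes AA A :: "('h::chilbert \<Rightarrow>\<^sub>L 'h) set"
  assumes "unital_cstar_subalg AA"
    and "Kset \<subseteq> AA"
    and "\<forall>a\<in>AA. \<forall>b\<in>AA. (a o\<^sub>L b) - (b o\<^sub>L a) \<in> Kset"
    and "unital_closed_subalg A"
    and "A \<subseteq> AA"
    and "\<forall>\<omega>. character AA \<omega> \<longrightarrow>
           (\<exists>t\<in>A. pure_contraction t \<and> \<omega> t = 1 \<and>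
              (\<forall>\<kappa>. character AA \<kappa> \<and> (\<exists>a\<in>AA. \<kappa> a \<noteq> \<omega> a) \<longrightarrow> cmod (\<kappa> t) < 1))"
  shows "\<forall>\<psi>. pure_state AA \<psi> \<longrightarrow>
           (\<exists>\<Delta>. characteristic_sequence AA \<psi> \<Delta> \<and> (\<forall>n. \<Delta> n \<in> opsys_plus_K A))"
proof (intro allI impI)
  fix \<psi> assume pure: "pure_state AA \<psi>"
  interpret essentially_commutative_cstar_algebra AA by unfold_locales (use assms in auto)
  interpret \<psi>: cstar_pure_state AA \<psi> by unfold_locales (rule pure)
  interpret A: unital_operator_algebra A by (rule unital_closed_subalg_imp_operator_algebra) fact
  have A_0: "0 \<in> A" by (rule subspace_0[OF A.subspace])
  show "\<exists>\<Delta>. characteristic_sequence AA \<psi> \<Delta> \<and> (\<forall>n. \<Delta> n \<in> opsys_plus_K A)"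
  proof (cases "\<forall>v e. \<psi> (rank1 v e) = 0")
    case False
    then obtain u where "characteristic_sequence AA \<psi> (\<lambda>n. rank1 u u)"
      using \<psi>.exists_rank1_characteristic_sequence[OF assms(2)] by blast
    then show ?thesis using Kset_subset_opsys_plus_K[OF A_0 rank1_Kset] by blast
  next
    case True
    then have null: "\<psi> k = 0" if "k \<in> Kset" for k
      using \<psi>.state_vanishes_on_Kset[OF assms(2)] that by blast
    have char: "character AA \<psi>" by (rule character_pure_state[OF pure null])
    then obtain t where t: "t \<in> A" "pure_contraction t" "peaks_at AA \<psi> t"
      using assms(6) unfolding peaks_at_def by blast
    then have "characteristic_sequence AA \<psi> (opow t)"
      using assms(5)
      by (intro characteristic_sequence_opow char \<psi>.state_le_essnorm assms(2) null) auto
    then show ?thesis using subset_opsys_plus_K[OF A_0] A.opow_closed[OF t(1)] by blast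
  qed
qed

end
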